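(* For all integers $3\le s\le t$, $\mathrm{ex}(n,\mathcal F_{1,s,t})=O\!\left(n^{1+\frac{s^2+1}{2s+2s^2}}\right)$; that is, there is a constant $C=C(s,t)$ such that every $n$-vertex graph containing no member of $\mathcal F_{1,s,t}$ as a subgraph has at most $C\,n^{1+\frac{s^2+1}{2s+2s^2}}$ edges.
   Context: For a family $\mathcal F$ of graphs, $\mathrm{ex}(n,\mathcal F)$ is the maximum number of edges in an $n$-vertex graph containing no (not necessarily induced) subgraph isomorphic to a member of $\mathcal F$. The family $\mathcal F_{1,s,t}$ is defined as follows. Start with the $1$-subdivision of the complete bipartite graph $K_{s,t}$: take vertices $y_1,\dots,y_s$ and $z_1,\dots,z_t$, and for every $i\in\{1,\dots,s\}$, $j\in\{1,\dots,t\}$ add a new vertex $b_{ij}$ adjacent to exactly $y_i$ and $z_j$. Add a further new vertex $r$. Then, one by one for each of the vertices $w\in\{y_1,\dots,y_s,z_1,\dots,z_t\}$, select a vertex $b$ which is either one of the vertices $b_{ij}$, or a brand new vertex, or a vertex that was added as a new vertex at an earlier step of this process, and join $b$ to $w$ and to $r$ (edges already present are not duplicated). $\mathcal F_{1,s,t}$ is the (finite) family of all bipartite graphs obtainable in this way. In particular it contains the $1$-subdivision of the complete tripartite graph $K_{1,s,t}$ (obtained by always choosing a brand new vertex). Here the $1$-subdivision of a graph replaces every edge by a path of length two. *)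

theory Defs
  imports Complex_Main "HOL-Library.Landau_Symbols"
begin

type_synonym 'a ugraph = "'a set \<times> 'a set set"

abbreviation verts :: "'a ugraph \<Rightarrow> 'a set" where "verts G \<equiv> fst G"
abbreviation edges :: "'a ugraph \<Rightarrow> 'a set set" where "edges G \<equiv> snd G"

definition simple_graph :: "'a ugraph \<Rightarrow> bool" where
  "simple_graph G \<longleftrightarrow> finite (verts G) \<and> (\<forall>e \<in> edges G. e \<subseteq> verts G \<and> card e = 2)"

definition bipartite :: "'a ugraph \<Rightarrow> bool" where
  "bipartite G \<longleftrightarrow> (\<exists>A B. verts G = A \<union> B \<and> A \<inter> B = {} \<and>
     (\<forall>e \<in> edges G. \<exists>a \<in> A. \<exists>b \<in> B. e = {a, b}))"

text \<open>Subgraphs are not required to be induced.\<close>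

definition subgraph_of :: "'a ugraph \<Rightarrow> 'a ugraph \<Rightarrow> bool" where
  "subgraph_of H G \<longleftrightarrow> simple_graph H \<and> verts H \<subseteq> verts G \<and> edges H \<subseteq> edges G"

definition graph_iso :: "'a ugraph \<Rightarrow> 'b ugraph \<Rightarrow> bool" where
  "graph_iso G H \<longleftrightarrow> (\<exists>f. bij_betw f (verts G) (verts H) \<and>
     (\<forall>u \<in> verts G. \<forall>v \<in> verts G. {u, v} \<in> edges G \<longleftrightarrow> {f u, f v} \<in> edges H))"

definition family_free :: "'b ugraph set \<Rightarrow> 'a ugraph \<Rightarrow> bool" where
  "family_free \<F> G \<longleftrightarrow> \<not> (\<exists>F \<in> \<F>. \<exists>H. subgraph_of H G \<and> graph_iso F H)"

text \<open>
  Every finite graph is isomorphic to one whose vertices are natural numbers, so the extremal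
  number may be taken over these. The set below is bounded by the number of pairs; it is nonempty
  (contains 0) whenever every member of \<open>\<F>\<close> has an edge.
\<close>

definition ex_num :: "nat \<Rightarrow> 'b ugraph set \<Rightarrow> nat" where
  "ex_num n \<F> = Max {card (edges G) | G :: nat ugraph.
     simple_graph G \<and> card (verts G) = n \<and> family_free \<F> G}"

datatype fvert = Y nat | Z nat | B nat nat | R | New nat

definition branch_verts :: "nat \<Rightarrow> nat \<Rightarrow> fvert set" where
  "branch_verts s t = Y ` {1..s} \<union> Z ` {1..t}"

definition mid_verts :: "nat \<Rightarrow> nat \<Rightarrow> fvert set" where
  "mid_verts s t = {B i j | i j. i \<in> {1..s} \<and> j \<in> {1..t}}"

definition base_graph :: "nat \<Rightarrow> nat \<Rightarrow> fvert ugraph" where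
  "base_graph s t =
     (branch_verts s t \<union> mid_verts s t \<union> {R},
      {{Y i, B i j} | i j. i \<in> {1..s} \<and> j \<in> {1..t}} \<union>
      {{Z j, B i j} | i j. i \<in> {1..s} \<and> j \<in> {1..t}})"

definition join_to :: "fvert \<Rightarrow> fvert \<Rightarrow> fvert ugraph \<Rightarrow> fvert ugraph" where
  "join_to b w G = (insert b (verts G), edges G \<union> {{b, w}, {b, R}})"

text \<open>
  \<open>build s t W G m\<close>: the process has dealt with the branch vertices in \<open>W\<close>, the current
  graph is \<open>G\<close>, and the vertices added so far are \<open>New 0, \<dots>, New (m - 1)\<close>.
\<close>

inductive build :: "nat \<Rightarrow> nat \<Rightarrow> fvert set \<Rightarrow> fvert ugraph \<Rightarrow> nat \<Rightarrow> bool" for s t where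
  start: "build s t {} (base_graph s t) 0"
| reuse: "build s t W G m \<Longrightarrow> w \<in> branch_verts s t - W \<Longrightarrow>
    b \<in> mid_verts s t \<union> New ` {..<m} \<Longrightarrow> build s t (insert w W) (join_to b w G) m"
| fresh: "build s t W G m \<Longrightarrow> w \<in> branch_verts s t - W \<Longrightarrow>
    build s t (insert w W) (join_to (New m) w G) (Suc m)"

definition F_family :: "nat \<Rightarrow> nat \<Rightarrow> fvert ugraph set" where
  "F_family s t = {G. bipartite G \<and> (\<exists>m. build s t (branch_verts s t) G m)}"

text \<open>The process only ever produces bipartite simple graphs.\<close>

lemma build_verts:
  assumes "build s t W G m"
  shows "verts G = (branch_verts s t \<union> {R}) \<union> (mid_verts s t \<union> New ` {..<m})"
  using assms by induction (auto simp: base_graph_def join_to_def)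

lemma build_edges:
  assumes "build s t W G m"
  shows "edges G \<subseteq> (\<lambda>(a, b). {a, b}) `
    ((branch_verts s t \<union> {R}) \<times> (mid_verts s t \<union> New ` {..<m}))" (is "_ \<subseteq> ?E m")
  using assms
proof induction
  case start
  show ?case
  proof
    fix e assume "e \<in> edges (base_graph s t)"
    then obtain i j where ij: "i \<in> {1..s}" "j \<in> {1..t}" "e = {Y i, B i j} \<or> e = {Z j, B i j}"
      by (auto simp: base_graph_def)
    have "Y i \<in> branch_verts s t" "Z j \<in> branch_verts s t" "B i j \<in> mid_verts s t"
      using ij by (auto simp: branch_verts_def mid_verts_def)
    then have "(Y i, B i j) \<in> (branch_verts s t \<union> {R}) \<times> (mid_verts s t \<union> New ` {..<0})"
      and "(Z j, B i j) \<in> (branch_verts s t \<union> {R}) \<times> (mid_verts s t \<union> New ` {..<0})"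
      by auto
    from this[THEN imageI[of _ _ "\<lambda>(a, b). {a, b}"]] show "e \<in> ?E 0"
      using ij(3) by auto
  qed
next
  case (reuse W G m w b)
  have "{b, w} \<in> ?E m"
    by (rule image_eqI[of _ _ "(w, b)"]) (use reuse in auto)
  moreover have "{b, R} \<in> ?E m"
    by (rule image_eqI[of _ _ "(R, b)"]) (use reuse in auto)
  ultimately show ?case using reuse.IH by (simp add: join_to_def)
next
  case (fresh W G m w)
  have "{New m, w} \<in> ?E (Suc m)"
    by (rule image_eqI[of _ _ "(w, New m)"]) (use fresh in auto)
  moreover have "{New m, R} \<in> ?E (Suc m)"
    by (rule image_eqI[of _ _ "(R, New m)"]) auto
  moreover have "?E m \<subseteq> ?E (Suc m)"
    by (intro image_mono Sigma_mono Un_mono) auto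
  ultimately show ?case using fresh.IH unfolding join_to_def snd_conv
    by (meson Un_least empty_subsetI insert_subset subset_trans)
qed

lemma build_disjoint:
  "(branch_verts s t \<union> {R}) \<inter> (mid_verts s t \<union> New ` {..<m}) = {}"
  by (auto simp: branch_verts_def mid_verts_def)

lemma build_edgeE:
  assumes "build s t W G m" and "e \<in> edges G"
  obtains a b where "a \<in> branch_verts s t \<union> {R}" "b \<in> mid_verts s t \<union> New ` {..<m}" "e = {a, b}"
proof -
  obtain p where "p \<in> (branch_verts s t \<union> {R}) \<times> (mid_verts s t \<union> New ` {..<m})"
    "e = (\<lambda>(a, b). {a, b}) p"
    using build_edges[OF assms(1)] assms(2) by (meson imageE subsetD)
  then show thesis using that[of "fst p" "snd p"] by (simp add: case_prod_beta mem_Times_iff)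
qed

lemma build_bipartite:
  assumes "build s t W G m"
  shows "bipartite G"
  unfolding bipartite_def
  by (intro exI conjI, rule build_verts[OF assms], rule build_disjoint)
    (meson build_edgeE[OF assms])

lemma build_simple_graph:
  assumes "build s t W G m"
  shows "simple_graph G"
proof -
  have "mid_verts s t = (\<lambda>(i, j). B i j) ` ({1..s} \<times> {1..t})"
    by (auto simp: mid_verts_def)
  then have "finite (mid_verts s t)" by simp
  moreover have "finite (branch_verts s t)" by (simp add: branch_verts_def)
  ultimately have "finite (verts G)" using build_verts[OF assms] by simp
  moreover have "e \<subseteq> verts G \<and> card e = 2" if e: "e \<in> edges G" for e
  proof -
    obtain a b where ab: "a \<in> branch_verts s t \<union> {R}" "b \<in> mid_verts s t \<union> New ` {..<m}" "e = {a, b}"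
      using build_edgeE[OF assms e] .
    then have "a \<noteq> b" using build_disjoint by blast
    then show ?thesis using ab build_verts[OF assms] by auto
  qed
  ultimately show ?thesis by (simp add: simple_graph_def)
qed

end

theory Submission
  imports Defs "HOL-Library.FuncSet" "HOL-Analysis.Convex"
begin

text \<open>
  Since the vertices joined to \<open>r\<close> may be chosen freely, it suffices to find, in a bipartite subgraph with
  sides \<open>A\<close> and \<open>M\<close>, a vertex \<open>r \<in> A\<close> and a subdivided \<open>K\<^bsub>s,t\<^esub>\<close> whose branch vertices lie
  in \<open>A\<close> at distance two from \<open>r\<close>. A pair in \<open>A\<close> is light if it has between \<open>1\<close> and \<open>st - 1\<close> common
  neighbours. A clique of \<open>1 + s + t\<close> heavy pairs already contains the configuration, so a positive
  proportion of the pairs inside each large neighbourhood is light.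

  Pick \<open>r\<close> with many light neighbours, let \<open>X\<close> be the set of these and \<open>p\<close> the density of light pairs
  in \<open>X\<close>. For an \<open>s\<close>-tuple \<open>S\<close> in \<open>X\<close>, a maximal family of common light neighbours with
  disjoint connections to \<open>S\<close> has fewer than \<open>t\<close> members, so a fixed proportion of the common light
  neighbours of \<open>S\<close> is adjacent to a single \<open>b \<in> M\<close>, itself adjacent to some entry \<open>S\<^sub>i\<close>. Hence, for
  a typical \<open>(s-1)\<close>-tuple \<open>T\<close>, most edges leaving the set \<open>V\<close> of its common light neighbours go to
  vertices \<open>b\<close> having at least \<open>\<epsilon> p |V|\<close> neighbours in \<open>V\<close>; this produces more light pairs than
  \<open>V\<close> can hold, as soon as \<open>p\<^sup>2 |X|\<close> exceeds a constant multiple of the maximum degree on the side \<open>M\<close>.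
  A dyadic choice of \<open>M\<close> makes this degree comparable to the average; its logarithmic cost is absorbed
  because the argument works with some room below the claimed exponent.
\<close>

section \<open>Greedy choice, dense graphs, sums over tuples, and the configuration sought\<close>

text \<open>When an index is added, the values already used are fewer than the elements available to
  it. This supplies the \<open>s * t\<close> distinct middle vertices of a subdivided complete
  bipartite graph.\<close>

lemma greedy_distinct_representatives:
  assumes "finite I" and "\<And>i. i \<in> I \<Longrightarrow> finite (F i)" and "\<And>i. i \<in> I \<Longrightarrow> card I \<le> card (F i)"
  shows "\<exists>f. inj_on f I \<and> (\<forall>i\<in>I. f i \<in> F i)"
  using assms
proof (induction I rule: finite_induct)
  case (insert x I)
  then have "\<exists>f. inj_on f I \<and> (\<forall>i\<in>I. f i \<in> F i)"
    by (metis card_insert_disjoint insertCI Suc_leD)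
  then obtain f where f: "inj_on f I" "\<forall>i\<in>I. f i \<in> F i" by blast
  have "card (f ` I) < card (F x)"
    using insert card_image_le[of I f] by (metis card_insert_disjoint insertI1 le_trans not_less_eq_eq not_le)
  then have "\<not> F x \<subseteq> f ` I"
    using insert.hyps by (meson card_mono finite_imageI leD)
  then obtain y where y: "y \<in> F x" "y \<notin> f ` I" by blast
  have "inj_on (f(x := y)) (insert x I)"
    using f y insert.hyps by (auto simp: inj_on_def)
  moreover have "\<forall>i\<in>insert x I. (f(x := y)) i \<in> F i"
    using f y insert.hyps by auto
  ultimately show ?case by blast
qed auto

text \<open>Induction on \<open>k\<close>: averaging yields a vertex \<open>v\<close> with few
  non-neighbours, whose neighbourhood keeps at least half of \<open>X\<close>. Halving costs a
  factor \<open>4\<close> in \<open>card X ^ 2\<close>, which is what passing from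
  \<open>4 ^ Suc k\<close> to \<open>4 ^ k\<close> provides.\<close>

lemma clique_if_few_nonadjacent_pairs:
  assumes "finite X" and sym: "\<And>u v. H u v \<Longrightarrow> H v u"
    and "4 ^ k \<le> card X"
    and "4 ^ k * card {(u, v) \<in> X \<times> X. u \<noteq> v \<and> \<not> H u v} < card X ^ 2"
  shows "\<exists>K \<subseteq> X. card K = k \<and> (\<forall>u\<in>K. \<forall>v\<in>K. u \<noteq> v \<longrightarrow> H u v)"
  using assms(1,3,4)
proof (induction k arbitrary: X)
  case 0
  then show ?case by (intro exI[of _ "{}"]) auto
next
  case (Suc k)
  let ?L = "\<lambda>X. {(u, v) \<in> X \<times> X. u \<noteq> v \<and> \<not> H u v}"
  let ?l = "\<lambda>v. card {u \<in> X. v \<noteq> u \<and> \<not> H v u}"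
  have LX: "card (?L X) = (\<Sum>v\<in>X. ?l v)"
  proof -
    have "?L X = (SIGMA v:X. {u \<in> X. v \<noteq> u \<and> \<not> H v u})" by auto
    then show ?thesis using Suc.prems(1) by (simp add: card_SigmaI)
  qed
  have "\<exists>v\<in>X. 4 ^ Suc k * ?l v < card X"
  proof (rule ccontr)
    assume "\<not> ?thesis"
    then have "(\<Sum>v\<in>X. card X) \<le> (\<Sum>v\<in>X. 4 ^ Suc k * ?l v)"
      by (intro sum_mono) (auto simp: not_less)
    also have "\<dots> = 4 ^ Suc k * card (?L X)" by (simp only: LX sum_distrib_left)
    finally show False using Suc.prems(3) by (simp add: power2_eq_square)
  qed
  then obtain v where v: "v \<in> X" "4 ^ Suc k * ?l v < card X" by blast
  define X' where "X' = {u \<in> X. u \<noteq> v \<and> H v u}"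
  have "X = insert v (X' \<union> {u \<in> X. v \<noteq> u \<and> \<not> H v u})"
    using v by (auto simp: X'_def)
  then have "card X \<le> card (X' \<union> {u \<in> X. v \<noteq> u \<and> \<not> H v u}) + 1"
    using card_Un_le[of "{v}" "X' \<union> {u \<in> X. v \<noteq> u \<and> \<not> H v u}"] by simp
  also have "\<dots> \<le> card X' + ?l v + 1" using card_Un_le by auto
  finally have c1: "card X \<le> card X' + ?l v + 1" .
  have "4 * ?l v \<le> 4 ^ Suc k * ?l v" by (intro mult_right_mono) auto
  with v have c2: "4 * ?l v < card X" by linarith
  have c3: "4 * 4 ^ k \<le> card X" using Suc.prems(2) by simp
  have "(1::nat) \<le> 4 ^ k" by simp
  \<comment> \<open>The non-neighbours of \<open>v\<close> take less than a quarter of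
    \<open>X\<close>; since \<open>card X \<ge> 4\<close>, the vertex \<open>v\<close> itself takes
    at most another quarter.\<close>
  with c1 c2 c3 have half: "card X \<le> 2 * card X'" by linarith
  have fin': "finite X'" using Suc.prems(1) by (simp add: X'_def)
  have "4 ^ k \<le> card X'" using half c3 by linarith
  moreover have "4 ^ k * card (?L X') < card X' ^ 2"
  proof -
    have "card (?L X') \<le> card (?L X)"
      using Suc.prems(1) by (intro card_mono finite_subset[of "?L X" "X \<times> X"]) (auto simp: X'_def)
    then have "4 * (4 ^ k * card (?L X')) \<le> 4 ^ Suc k * card (?L X)" by simp
    also have "\<dots> < card X ^ 2" by (rule Suc.prems(3))
    also have "\<dots> \<le> (2 * card X') ^ 2" using half by (intro power_mono) auto
    finally show ?thesis by (simp add: power2_eq_square)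
  qed
  ultimately obtain K where K: "K \<subseteq> X'" "card K = k" "\<forall>u\<in>K. \<forall>v\<in>K. u \<noteq> v \<longrightarrow> H u v"
    using Suc.IH[OF fin'] by blast
  have "v \<notin> K" using K by (auto simp: X'_def)
  then have "card (insert v K) = Suc k" using K fin' by (simp add: finite_subset)
  moreover have "insert v K \<subseteq> X" using K v by (auto simp: X'_def)
  moreover have "\<forall>u\<in>insert v K. \<forall>w\<in>insert v K. u \<noteq> w \<longrightarrow> H u w"
    using K sym by (auto simp: X'_def)
  ultimately show ?case by blast
qed

text \<open>A tuple is its entry at \<open>i\<close> together with the rest. With the summand in the
  form \<open>g T u\<close>, estimates can be made for fixed \<open>T\<close> while \<open>u\<close>
  runs over \<open>X\<close>.\<close>

lemma sum_PiE_split: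
  fixes g :: "('i \<Rightarrow> 'a) \<Rightarrow> 'a \<Rightarrow> real"
  assumes "i \<in> I" "finite I" "finite X"
  shows "(\<Sum>S\<in>PiE I (\<lambda>_. X). g (restrict S (I - {i})) (S i)) =
         (\<Sum>T\<in>PiE (I - {i}) (\<lambda>_. X). \<Sum>u\<in>X. g T u)"
proof -
  let ?P = "PiE (I - {i}) (\<lambda>_. X)"
  have ins: "insert i (I - {i}) = I" using assms(1) by auto
  have inj: "inj_on (\<lambda>(u, T). T(i := u)) (X \<times> ?P)"
    by (rule inj_combinator) simp
  have "(\<Sum>S\<in>PiE I (\<lambda>_. X). g (restrict S (I - {i})) (S i)) =
     (\<Sum>(u, T)\<in>X \<times> ?P. g (restrict (T(i := u)) (I - {i})) u)"
    using PiE_insert_eq[of i "I - {i}" "\<lambda>_. X"]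
    unfolding ins by (simp only: sum.reindex[OF inj]) (simp add: case_prod_beta)
  also have "\<dots> = (\<Sum>(u, T)\<in>X \<times> ?P. g T u)"
  proof (intro sum.cong refl, clarify)
    fix u T assume "T \<in> ?P"
    then have "restrict (T(i := u)) (I - {i}) = T"
      by (auto simp: fun_eq_iff restrict_def PiE_def extensional_def)
    then show "g (restrict (T(i := u)) (I - {i})) u = g T u" by simp
  qed
  also have "\<dots> = (\<Sum>u\<in>X. \<Sum>T\<in>?P. g T u)" by (simp add: sum.cartesian_product)
  also have "\<dots> = (\<Sum>T\<in>?P. \<Sum>u\<in>X. g T u)" by (rule sum.swap)
  finally show ?thesis by simp
qed

text \<open>A form of Chebyshev's sum inequality: \<open>d v - x\<close> and
  \<open>d v ^ k - x ^ k\<close> have the same sign. The leftover term is nonnegative because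
  \<open>x\<close> bounds the average of \<open>d\<close> from below. For degrees \<open>d\<close>
  this compares the counts of tuples of consecutive lengths.\<close>

lemma sum_power_Suc_ge:
  fixes d :: "'a \<Rightarrow> real" and x :: real
  assumes "finite X" "\<And>v. v \<in> X \<Longrightarrow> 0 \<le> d v" "0 \<le> x" "card X * x \<le> (\<Sum>v\<in>X. d v)"
  shows "x * (\<Sum>v\<in>X. d v ^ k) \<le> (\<Sum>v\<in>X. d v ^ Suc k)"
proof -
  have "0 \<le> (d v - x) * (d v ^ k - x ^ k)" if "v \<in> X" for v
  proof (cases "d v \<le> x")
    case True
    then show ?thesis using assms(2)[OF that] by (intro mult_nonpos_nonpos) (auto intro: power_mono)
  next
    case False
    then show ?thesis using assms(3) by (intro mult_nonneg_nonneg) (auto intro: power_mono)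
  qed
  then have "0 \<le> (\<Sum>v\<in>X. (d v - x) * (d v ^ k - x ^ k))" by (intro sum_nonneg)
  also have "\<dots> = (\<Sum>v\<in>X. d v ^ Suc k) - x * (\<Sum>v\<in>X. d v ^ k)
      - x ^ k * ((\<Sum>v\<in>X. d v) - card X * x)"
    by (simp add: algebra_simps sum.distrib sum_subtractf sum_distrib_left sum_distrib_right)
  finally have "x ^ k * ((\<Sum>v\<in>X. d v) - card X * x) \<le>
      (\<Sum>v\<in>X. d v ^ Suc k) - x * (\<Sum>v\<in>X. d v ^ k)" by simp
  moreover have "0 \<le> x ^ k * ((\<Sum>v\<in>X. d v) - card X * x)"
    using assms(3,4) by (intro mult_nonneg_nonneg) auto
  ultimately show ?thesis by linarith
qed

text \<open>The vertices joining \<open>r\<close> to the branch vertices need not be distinct from each other or from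
  the \<open>b (i, j)\<close>.\<close>

definition has_config :: "nat \<Rightarrow> nat \<Rightarrow> 'a set \<Rightarrow> 'b set \<Rightarrow> ('a \<Rightarrow> 'b \<Rightarrow> bool) \<Rightarrow> bool" where
  "has_config s t A M E \<longleftrightarrow> (\<exists>r y z b. r \<in> A \<and> y ` {1..s} \<subseteq> A \<and> z ` {1..t} \<subseteq> A \<and>
     inj_on y {1..s} \<and> inj_on z {1..t} \<and> y ` {1..s} \<inter> z ` {1..t} = {} \<and>
     r \<notin> y ` {1..s} \<union> z ` {1..t} \<and>
     b ` ({1..s} \<times> {1..t}) \<subseteq> M \<and> inj_on b ({1..s} \<times> {1..t}) \<and>
     (\<forall>i\<in>{1..s}. \<forall>j\<in>{1..t}. E (y i) (b (i, j)) \<and> E (z j) (b (i, j))) \<and>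
     (\<forall>w\<in>y ` {1..s} \<union> z ` {1..t}. \<exists>c\<in>M. E r c \<and> E w c))"

section \<open>Light and heavy pairs in a bipartite graph without the configuration\<close>

locale config_free =
  fixes A :: "'a set" and M :: "'b set" and E :: "'a \<Rightarrow> 'b \<Rightarrow> bool" and s t :: nat
  assumes finA: "finite A" and finM: "finite M" and s_pos: "1 \<le> s" and t_pos: "1 \<le> t"
    and no_config: "\<not> has_config s t A M E"
begin

definition common :: "'a \<Rightarrow> 'a \<Rightarrow> 'b set" where
  "common u v = {b \<in> M. E u b \<and> E v b}"

definition nbhd :: "'b \<Rightarrow> 'a set" where
  "nbhd b = {v \<in> A. E v b}"

text \<open>A pair with at least \<open>s * t\<close> common neighbours never obstructs a greedy
  choice of \<open>s * t\<close> middle vertices. Nonemptiness places every light neighbour of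
  \<open>r\<close> at distance two from \<open>r\<close>.\<close>

definition light :: "'a \<Rightarrow> 'a \<Rightarrow> bool" where
  "light u v \<longleftrightarrow> u \<in> A \<and> v \<in> A \<and> u \<noteq> v \<and> common u v \<noteq> {} \<and> card (common u v) < s * t"

definition light_pairs :: "'a set \<Rightarrow> ('a \<times> 'a) set" where
  "light_pairs X = {(u, v) \<in> X \<times> X. light u v}"

text \<open>The constant of \<open>clique_if_few_nonadjacent_pairs\<close> for a clique providing
  \<open>r\<close>, the \<open>s\<close> vertices \<open>y i\<close> and the \<open>t\<close>
  vertices \<open>z j\<close>.\<close>

abbreviation q :: nat where "q \<equiv> 4 ^ (1 + s + t)"

lemma fin_common [simp]: "finite (common u v)"
  using finM by (simp add: common_def)

lemma fin_nbhd [simp]: "finite (nbhd b)"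
  using finA by (simp add: nbhd_def)

lemma common_commute: "common u v = common v u"
  by (auto simp: common_def)

lemma fin_light_pairs: "finite X \<Longrightarrow> finite (light_pairs X)"
  by (rule finite_subset[of _ "X \<times> X"]) (auto simp: light_pairs_def)

text \<open>Any labelling of the clique by \<open>r\<close>, \<open>y i\<close> and
  \<open>z j\<close> works: every pair \<open>y i\<close>, \<open>z j\<close> has enough common
  neighbours for a greedy choice of distinct ones, and \<open>r\<close> has a common neighbour with
  every other vertex.\<close>

lemma no_heavy_clique:
  assumes "K \<subseteq> A" "card K = 1 + s + t"
    and heavy: "\<And>u v. u \<in> K \<Longrightarrow> v \<in> K \<Longrightarrow> u \<noteq> v \<Longrightarrow> s * t \<le> card (common u v)"
  shows False
proof -
  have "finite K" using assms(2) card.infinite by fastforce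
  then obtain f where f: "bij_betw f {0..<1 + s + t} K"
    using ex_bij_betw_nat_finite[of K] assms(2) by auto
  have inj: "inj_on f {0..<1 + s + t}" and img: "f ` {0..<1 + s + t} = K"
    using f by (auto simp: bij_betw_def)
  \<comment> \<open>Index \<open>0\<close> is reserved for \<open>r\<close>, indices
    \<open>1\<close> to \<open>s\<close> for the \<open>y i\<close>, and the next \<open>t\<close>
    for the \<open>z j\<close>.\<close>
  define y where "y = f"
  define z where "z = (\<lambda>j. f (s + j))"
  have inK: "f k \<in> K" if "k < 1 + s + t" for k using img that by auto
  have ne: "f k \<noteq> f l" if "k < 1 + s + t" "l < 1 + s + t" "k \<noteq> l" for k l
    using inj that by (auto simp: inj_on_def)
  have "\<exists>b. inj_on b ({1..s} \<times> {1..t}) \<and>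
     (\<forall>ij\<in>{1..s} \<times> {1..t}. b ij \<in> common (y (fst ij)) (z (snd ij)))"
  proof (rule greedy_distinct_representatives)
    fix ij assume "ij \<in> {1..s} \<times> {1..t}"
    then show "card ({1..s} \<times> {1..t}) \<le> card (common (y (fst ij)) (z (snd ij)))"
      using heavy[OF inK inK ne, of "fst ij" "s + snd ij"] by (auto simp: y_def z_def)
  qed auto
  then obtain b where b: "inj_on b ({1..s} \<times> {1..t})"
    "\<And>i j. i \<in> {1..s} \<Longrightarrow> j \<in> {1..t} \<Longrightarrow> b (i, j) \<in> common (y i) (z j)" by fastforce
  have st: "1 \<le> s * t" using s_pos t_pos by simp
  have c: "\<exists>c\<in>M. E (f 0) c \<and> E w c" if "w \<in> K" "w \<noteq> f 0" for w
  proof -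
    have "1 \<le> card (common (f 0) w)" using le_trans[OF st heavy[OF inK[of 0] that(1)]] that(2) by simp
    then have "common (f 0) w \<noteq> {}" by force
    then show ?thesis by (auto simp: common_def)
  qed
  have yz: "y ` {1..s} \<union> z ` {1..t} \<subseteq> K - {f 0}"
  proof -
    have "y i \<in> K - {f 0}" if "i \<in> {1..s}" for i
      using ne[of i 0] inK[of i] that by (auto simp: y_def)
    moreover have "z j \<in> K - {f 0}" if "j \<in> {1..t}" for j
      using ne[of "s + j" 0] inK[of "s + j"] that by (auto simp: z_def)
    ultimately show ?thesis by (intro Un_least image_subsetI)
  qed
  have "has_config s t A M E"
    unfolding has_config_def
  proof (rule exI[of _ "f 0"], rule exI[of _ y], rule exI[of _ z], rule exI[of _ b], intro conjI)
    show "f 0 \<in> A" using inK[of 0] assms(1) by auto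
    show "y ` {1..s} \<subseteq> A" "z ` {1..t} \<subseteq> A" using yz assms(1) by auto
    show "inj_on y {1..s}" using inj by (auto simp: y_def inj_on_def)
    show "inj_on z {1..t}"
    proof (rule inj_onI, rule ccontr)
      fix i j assume "i \<in> {1..t}" "j \<in> {1..t}" "z i = z j" "i \<noteq> j"
      then show False using ne[of "s + i" "s + j"] by (auto simp: z_def)
    qed
    show "y ` {1..s} \<inter> z ` {1..t} = {}"
    proof -
      have "y i \<noteq> z j" if "i \<in> {1..s}" "j \<in> {1..t}" for i j
        using ne[of i "s + j"] that by (auto simp: y_def z_def)
      then show ?thesis by fast
    qed
    show "f 0 \<notin> y ` {1..s} \<union> z ` {1..t}" using yz by auto
    show "b ` ({1..s} \<times> {1..t}) \<subseteq> M" using b(2) by (auto simp: common_def)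
    show "inj_on b ({1..s} \<times> {1..t})" by fact
    show "\<forall>i\<in>{1..s}. \<forall>j\<in>{1..t}. E (y i) (b (i, j)) \<and> E (z j) (b (i, j))"
      using b(2) by (auto simp: common_def)
    show "\<forall>w\<in>y ` {1..s} \<union> z ` {1..t}. \<exists>c\<in>M. E (f 0) c \<and> E w c"
      using yz c by blast
  qed
  then show False using no_config by simp
qed

text \<open>Any two vertices of \<open>nbhd b\<close> share \<open>b\<close>, so within
  \<open>X\<close> the pairs that are not heavy are exactly the light ones. Too few of them would
  leave a heavy clique.\<close>

lemma many_light_pairs_in_nbhd:
  assumes "X \<subseteq> nbhd b" "b \<in> M" "q \<le> card X"
  shows "card X ^ 2 \<le> q * card (light_pairs X)"
proof (rule ccontr)
  assume less: "\<not> ?thesis"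
  let ?H = "\<lambda>u v. s * t \<le> card (common u v)"
  have XA: "X \<subseteq> A" and fin: "finite X" using assms(1) by (auto simp: nbhd_def intro: finite_subset[OF _ finA])
  have "common u v \<noteq> {}" if "u \<in> X" "v \<in> X" for u v
    using that assms by (auto simp: nbhd_def common_def)
  then have "{(u, v) \<in> X \<times> X. u \<noteq> v \<and> \<not> ?H u v} = light_pairs X"
    using XA by (auto simp: light_pairs_def light_def)
  then have "\<exists>K \<subseteq> X. card K = 1 + s + t \<and> (\<forall>u\<in>K. \<forall>v\<in>K. u \<noteq> v \<longrightarrow> ?H u v)"
    using less assms(3) fin by (intro clique_if_few_nonadjacent_pairs) (auto simp: common_commute)
  then show False using no_heavy_clique XA by (meson subset_trans)
qed

text \<open>Double counting of light pairs together with a common neighbour in \<open>M0\<close>: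
  each pair is counted fewer than \<open>s * t\<close> times, while each \<open>b\<close>
  contributes at least a fraction \<open>1 / q\<close> of the square of its degree into
  \<open>X\<close>.\<close>

lemma sum_nbhd_squares_le:
  assumes "X \<subseteq> A" "M0 \<subseteq> M" and large: "\<And>b. b \<in> M0 \<Longrightarrow> q \<le> card (X \<inter> nbhd b)"
  shows "(\<Sum>b\<in>M0. card (X \<inter> nbhd b) ^ 2) \<le> q * (s * t) * card (light_pairs X)"
proof -
  have finX: "finite X" and finM0: "finite M0" using assms finA finM finite_subset by auto
  note finL = fin_light_pairs[OF finX]
  have "(\<Sum>b\<in>M0. card (X \<inter> nbhd b) ^ 2) \<le> (\<Sum>b\<in>M0. q * card (light_pairs (X \<inter> nbhd b)))"
    using assms by (intro sum_mono many_light_pairs_in_nbhd) auto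
  also have "\<dots> = q * (\<Sum>b\<in>M0. \<Sum>x\<in>light_pairs X. if E (fst x) b \<and> E (snd x) b then 1 else 0)"
  proof -
    have "light_pairs (X \<inter> nbhd b) = {x \<in> light_pairs X. E (fst x) b \<and> E (snd x) b}" for b
      using assms(1) by (auto simp: light_pairs_def nbhd_def)
    then have "card (light_pairs (X \<inter> nbhd b)) =
      (\<Sum>x\<in>light_pairs X. if E (fst x) b \<and> E (snd x) b then 1 else 0)" for b
      using finL by (simp add: sum.If_cases Int_def)
    then show ?thesis by (simp only: sum_distrib_left)
  qed
  also have "\<dots> = q * (\<Sum>x\<in>light_pairs X. card {b \<in> M0. E (fst x) b \<and> E (snd x) b})"
    by (subst sum.swap) (use finM0 in \<open>simp add: sum.If_cases Int_def\<close>)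
  also have "\<dots> \<le> q * (\<Sum>x\<in>light_pairs X. s * t)"
  proof (intro mult_left_mono sum_mono)
    fix x assume "x \<in> light_pairs X"
    then have "card (common (fst x) (snd x)) < s * t" by (auto simp: light_pairs_def light_def)
    moreover have "card {b \<in> M0. E (fst x) b \<and> E (snd x) b} \<le> card (common (fst x) (snd x))"
      using assms(2) by (intro card_mono fin_common) (auto simp: common_def)
    ultimately show "card {b \<in> M0. E (fst x) b \<and> E (snd x) b} \<le> s * t" by linarith
  qed auto
  finally show ?thesis by (simp add: mult_ac)
qed

text \<open>By \<open>e\<close>, vertices with fewer than \<open>q\<close> neighbours in
  \<open>X\<close> carry at most half of the edges. The others are handled by Cauchy-Schwarz and
  \<open>sum_nbhd_squares_le\<close>; the factor \<open>4\<close> is the square of the lost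
  \<open>2\<close>.\<close>

lemma light_pairs_lower_bound:
  assumes "X \<subseteq> A" and e: "2 * q * card M \<le> (\<Sum>b\<in>M. card (X \<inter> nbhd b))"
  shows "(\<Sum>b\<in>M. card (X \<inter> nbhd b)) ^ 2 \<le> 4 * q * (s * t) * card M * card (light_pairs X)"
proof -
  let ?d = "\<lambda>b. card (X \<inter> nbhd b)"
  let ?M0 = "{b \<in> M. q \<le> ?d b}"
  let ?e = "\<Sum>b\<in>M. ?d b"
  have "?e = sum ?d ?M0 + sum ?d {b \<in> M. \<not> q \<le> ?d b}"
    using finM by (subst sum.union_disjoint[symmetric]) (auto intro: sum.cong)
  also have "sum ?d {b \<in> M. \<not> q \<le> ?d b} \<le> card {b \<in> M. \<not> q \<le> ?d b} * q"
    using sum_bounded_above[of "{b \<in> M. \<not> q \<le> ?d b}" ?d q] by auto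
  also have "\<dots> \<le> card M * q" using finM by (intro mult_right_mono card_mono) auto
  finally have half: "?e \<le> 2 * sum ?d ?M0" using e by (simp add: algebra_simps)
  have "?e ^ 2 \<le> (2 * sum ?d ?M0) ^ 2" using half by (intro power_mono) auto
  also have "\<dots> = 4 * (sum ?d ?M0) ^ 2" by (simp add: power2_eq_square)
  also have "(sum ?d ?M0) ^ 2 \<le> (\<Sum>b\<in>?M0. ?d b ^ 2) * card ?M0"
  proof -
    have "(\<Sum>b\<in>?M0. real (?d b)) ^ 2 \<le> (\<Sum>b\<in>?M0. real (?d b) ^ 2) * card ?M0"
      by (rule sum_squared_le_sum_of_squares)
    then have "real ((sum ?d ?M0) ^ 2) \<le> real ((\<Sum>b\<in>?M0. ?d b ^ 2) * card ?M0)" by simp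
    then show ?thesis by (simp only: of_nat_le_iff)
  qed
  also have "\<dots> \<le> (q * (s * t) * card (light_pairs X)) * card M"
    using assms(1) finM by (intro mult_mono sum_nbhd_squares_le card_mono) auto
  finally show ?thesis by (simp add: algebra_simps)
qed

section \<open>Tuples and their common light neighbours\<close>

definition light_in :: "'a set \<Rightarrow> 'a \<Rightarrow> 'a set" where
  "light_in X v = {u \<in> X. light v u}"

text \<open>The index set \<open>J\<close> is a parameter so that full tuples and tuples with one
  entry removed are treated alike.\<close>

definition common_light :: "'a set \<Rightarrow> nat set \<Rightarrow> (nat \<Rightarrow> 'a) \<Rightarrow> 'a set" where
  "common_light X J T = {v \<in> X. \<forall>i\<in>J. light v (T i)}"

text \<open>For \<open>v\<close> with \<open>\<not> degenerate v S\<close> connecting vertices to different entries of \<open>S\<close> are automatically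
  distinct, and so are the entries of \<open>S\<close> itself.\<close>

definition degenerate :: "'a \<Rightarrow> (nat \<Rightarrow> 'a) \<Rightarrow> bool" where
  "degenerate v S \<longleftrightarrow> (\<exists>i\<in>{1..s}. \<exists>j\<in>{1..s}. i \<noteq> j \<and> (\<exists>b\<in>common v (S i). E (S j) b))"

text \<open>Candidates for the vertices \<open>z j\<close> when the entries of \<open>S\<close>
  serve as the \<open>y i\<close>.\<close>

definition spread :: "'a set \<Rightarrow> (nat \<Rightarrow> 'a) \<Rightarrow> 'a set" where
  "spread X S = {v \<in> common_light X {1..s} S. \<not> degenerate v S}"

text \<open>Fewer than \<open>t\<close> vertices, each with at most \<open>s\<close> sets of fewer than \<open>s * t\<close> connecting vertices,
  block all others; the last factor \<open>s\<close> counts the entries of the tuple.\<close>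

abbreviation \<kappa> :: nat where "\<kappa> \<equiv> t * s * (s * t) * s"

text \<open>Take a maximal family \<open>W\<close> in \<open>spread X S\<close> whose sets of
  connecting vertices are pairwise disjoint. Any \<open>t\<close> members give the configuration, so
  \<open>W\<close> is small. By maximality every vertex of \<open>spread X S\<close> is adjacent to
  a connecting vertex of \<open>W\<close>, and pigeonhole over these finishes the proof.\<close>

lemma spread_concentrated:
  assumes r: "r \<in> A" and X: "X = {v. light r v}" and S: "\<And>i. i \<in> {1..s} \<Longrightarrow> S i \<in> X"
    and ne: "spread X S \<noteq> {}"
  shows "\<exists>i\<in>{1..s}. \<exists>b\<in>M. E (S i) b \<and> card (spread X S) \<le> \<kappa> * card (spread X S \<inter> nbhd b)"
proof -
  let ?V = "spread X S"
  define P where "P v = (\<Union>i\<in>{1..s}. common v (S i))" for v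
  have XA: "X \<subseteq> A" using X by (auto simp: light_def)
  have finX: "finite X" using XA finA finite_subset by auto
  have VX: "?V \<subseteq> X" by (auto simp: spread_def common_light_def)
  have finV: "finite ?V" using VX finX finite_subset by auto
  have lt: "light v (S i)" if "v \<in> ?V" "i \<in> {1..s}" for v i
    using that by (auto simp: spread_def common_light_def)
  have P_ne: "P v \<noteq> {}" if "v \<in> ?V" for v
    using lt[OF that, of 1] s_pos by (auto simp: P_def light_def)
  have card_P: "card (P v) \<le> s * (s * t)" if "v \<in> ?V" for v
  proof -
    have "card (P v) \<le> (\<Sum>i\<in>{1..s}. card (common v (S i)))"
      unfolding P_def by (rule card_UN_le) simp
    also have "\<dots> \<le> (\<Sum>i\<in>{1..s}. s * t)"
      using lt[OF that] by (intro sum_mono) (auto simp: light_def less_imp_le)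
    finally show ?thesis by simp
  qed
  define \<W> where "\<W> = {W. W \<subseteq> ?V \<and> (\<forall>v\<in>W. \<forall>w\<in>W. v \<noteq> w \<longrightarrow> P v \<inter> P w = {})}"
  have "finite \<W>" using finV by (auto simp: \<W>_def intro: finite_subset[of _ "Pow ?V"])
  moreover have "{} \<in> \<W>" by (simp add: \<W>_def)
  ultimately obtain W where W: "W \<in> \<W>" "\<forall>W'\<in>\<W>. W \<subseteq> W' \<longrightarrow> W = W'"
    using finite_has_maximal[of \<W>] by auto
  have WV: "W \<subseteq> ?V" and disj: "\<And>v w. v \<in> W \<Longrightarrow> w \<in> W \<Longrightarrow> v \<noteq> w \<Longrightarrow> P v \<inter> P w = {}"
    using W(1) by (auto simp: \<W>_def)
  have finW: "finite W" using WV finV finite_subset by auto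
  have card_W: "card W \<le> t"
  proof (rule ccontr)
    assume "\<not> card W \<le> t"
    then obtain W0 where W0: "W0 \<subseteq> W" "card W0 = t" "finite W0"
      using obtain_subset_with_card_n[of t W] by auto
    then obtain z where z: "bij_betw z {1..t} W0"
      using ex_bij_betw_nat_finite_1 by blast
    have inj_z: "inj_on z {1..t}" and z_img: "z ` {1..t} = W0" using z by (auto simp: bij_betw_def)
    have zW: "z j \<in> W" if "j \<in> {1..t}" for j using that z_img W0 by auto
    have zV: "z j \<in> ?V" if "j \<in> {1..t}" for j using zW[OF that] WV by auto
    define b where "b = (\<lambda>(i, j). SOME b. b \<in> common (z j) (S i))"
    have b: "b (i, j) \<in> common (z j) (S i)" if "i \<in> {1..s}" "j \<in> {1..t}" for i j
    proof -
      have "common (z j) (S i) \<noteq> {}" using lt[OF zV] that by (auto simp: light_def)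
      then show ?thesis unfolding b_def by (simp add: some_in_eq)
    qed
    have ndeg: "\<not> E (S j) c" if "v \<in> ?V" "i \<in> {1..s}" "j \<in> {1..s}" "i \<noteq> j" "c \<in> common v (S i)" for v i j c
      using that unfolding spread_def degenerate_def by blast
    have "has_config s t A M E"
      unfolding has_config_def
    proof (rule exI[of _ r], rule exI[of _ S], rule exI[of _ z], rule exI[of _ b], intro conjI)
      show "r \<in> A" by fact
      show SA: "S ` {1..s} \<subseteq> A" using S XA by auto
      have zX: "z ` {1..t} \<subseteq> X" using zV VX by blast
      then show "z ` {1..t} \<subseteq> A" using XA by auto
      show "inj_on S {1..s}"
      proof (rule inj_onI, rule ccontr)
        fix i j assume ij: "i \<in> {1..s}" "j \<in> {1..s}" "S i = S j" "i \<noteq> j"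
        \<comment> \<open>An equality \<open>S i = S j\<close> would make \<open>b (i, 1)\<close>
          adjacent to both entries, against the nondegeneracy of \<open>z 1\<close>.\<close>
        have 1: "1 \<in> {1..t}" using t_pos by simp
        show False using ndeg[OF zV[OF 1] ij(1,2,4) b[OF ij(1) 1]] b[OF ij(1) 1] ij(3)
          by (auto simp: common_def)
      qed
      show "inj_on z {1..t}" by fact
      show "S ` {1..s} \<inter> z ` {1..t} = {}"
        using lt[OF zV] by (fastforce simp: light_def)
      show "r \<notin> S ` {1..s} \<union> z ` {1..t}"
      proof -
        have "r \<notin> X" using X by (simp add: light_def)
        then show ?thesis using S zX by blast
      qed
      show "b ` ({1..s} \<times> {1..t}) \<subseteq> M" using b by (auto simp: common_def)
      show "inj_on b ({1..s} \<times> {1..t})"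
      proof (rule inj_onI, clarify)
        fix i j i' j' assume ij: "i \<in> {1..s}" "j \<in> {1..t}" "i' \<in> {1..s}" "j' \<in> {1..t}"
          and eq: "b (i, j) = b (i', j')"
        \<comment> \<open>Disjointness of the sets \<open>P\<close> separates different
          \<open>j\<close>; nondegeneracy separates different \<open>i\<close>.\<close>
        have "b (i, j) \<in> P (z j)" "b (i', j') \<in> P (z j')"
          unfolding P_def using b ij by blast+
        then have "P (z j) \<inter> P (z j') \<noteq> {}" using eq by auto
        then have "z j = z j'" using disj[OF zW[OF ij(2)] zW[OF ij(4)]] by blast
        then have jj: "j = j'" using inj_onD[OF inj_z _ ij(2,4)] by simp
        have "i = i'"
        proof (rule ccontr)
          assume "i \<noteq> i'"
          then show False using ndeg[OF zV[OF ij(2)] ij(1,3) _ b[OF ij(1,2)]] eq b[OF ij(3,4)] jj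
            by (auto simp: common_def)
        qed
        then show "i = i' \<and> j = j'" using jj by simp
      qed
      show "\<forall>i\<in>{1..s}. \<forall>j\<in>{1..t}. E (S i) (b (i, j)) \<and> E (z j) (b (i, j))"
        using b by (auto simp: common_def)
      have "\<exists>c\<in>M. E r c \<and> E w c" if "w \<in> X" for w
        using that X by (auto simp: light_def common_def)
      then show "\<forall>w\<in>S ` {1..s} \<union> z ` {1..t}. \<exists>c\<in>M. E r c \<and> E w c"
        using S zX by blast
    qed
    then show False using no_config by simp
  qed
  \<comment> \<open>The index \<open>i\<close> is kept along with \<open>b\<close> so that
    pigeonhole also yields an entry \<open>S i\<close> adjacent to \<open>b\<close>; this costs the
    last factor \<open>s\<close> of \<open>\<kappa>\<close>.\<close>
  define Q where "Q = {(b, i) \<in> (\<Union>w\<in>W. P w) \<times> {1..s}. E (S i) b}"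
  have P_M: "P w \<subseteq> M" for w by (auto simp: P_def common_def)
  have finP: "finite (P w)" for w by (auto simp: P_def)
  have finQ0: "finite ((\<Union>w\<in>W. P w) \<times> {1..s})" using finW finP by auto
  have finQ: "finite Q" using finQ0 by (rule finite_subset[rotated]) (auto simp: Q_def)
  have "card Q \<le> card ((\<Union>w\<in>W. P w) \<times> {1..s})"
    using finQ0 by (rule card_mono) (auto simp: Q_def)
  also have "\<dots> = card (\<Union>w\<in>W. P w) * s" by (simp add: card_cartesian_product)
  also have "card (\<Union>w\<in>W. P w) \<le> (\<Sum>w\<in>W. card (P w))" using finW by (rule card_UN_le)
  also have "(\<Sum>w\<in>W. card (P w)) \<le> (\<Sum>w\<in>W. s * (s * t))"
    using card_P WV by (intro sum_mono) auto
  also have "\<dots> = card W * (s * (s * t))" by simp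
  also have "\<dots> \<le> t * (s * (s * t))" using card_W by (intro mult_right_mono) auto
  finally have cardQ: "card Q \<le> \<kappa>" by (simp add: mult_ac)
  have cover: "\<exists>(b, i)\<in>Q. v \<in> nbhd b" if v: "v \<in> ?V" for v
  proof -
    have "\<exists>w\<in>W. P v \<inter> P w \<noteq> {}"
    proof (rule ccontr)
      assume no: "\<not> ?thesis"
      then have "insert v W \<in> \<W>" using v WV disj by (auto simp: \<W>_def)
      \<comment> \<open>Maximality forces \<open>v\<close> into \<open>W\<close>; but then
        \<open>P v\<close>, being nonempty, meets a member's set after all, namely itself.\<close>
      then have "v \<in> W" using W(2) by blast
      then show False using no P_ne[OF v] by blast
    qed
    then obtain w b where wb: "w \<in> W" "b \<in> P w" "b \<in> P v" by auto
    then obtain i where i: "i \<in> {1..s}" "b \<in> common v (S i)" by (auto simp: P_def)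
    have "v \<in> A" using v VX XA by auto
    then have "(b, i) \<in> Q" "v \<in> nbhd b" using wb i by (auto simp: Q_def common_def nbhd_def)
    then show ?thesis by blast
  qed
  have Q_ne: "Q \<noteq> {}" using ne cover by fastforce
  show ?thesis
  proof (rule ccontr)
    assume contr: "\<not> ?thesis"
    have less: "\<kappa> * card (?V \<inter> nbhd (fst x)) < card ?V" if xQ: "x \<in> Q" for x
    proof -
      obtain b i where x: "x = (b, i)" "i \<in> {1..s}" "E (S i) b" "b \<in> M"
        using xQ P_M unfolding Q_def by blast
      then show ?thesis using contr by (auto simp: not_le)
    qed
    have "?V \<subseteq> (\<Union>x\<in>Q. ?V \<inter> nbhd (fst x))" using cover by fastforce
    then have "card ?V \<le> card (\<Union>x\<in>Q. ?V \<inter> nbhd (fst x))"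
      using finV finQ by (intro card_mono) auto
    also have "\<dots> \<le> (\<Sum>x\<in>Q. card (?V \<inter> nbhd (fst x)))" using finQ by (rule card_UN_le)
    finally have "\<kappa> * card ?V \<le> (\<Sum>x\<in>Q. \<kappa> * card (?V \<inter> nbhd (fst x)))"
      by (metis mult_le_mono2 sum_distrib_left)
    also have "\<dots> < (\<Sum>x\<in>Q. card ?V)"
      using finQ Q_ne less by (intro sum_strict_mono) auto
    also have "\<dots> \<le> \<kappa> * card ?V" using cardQ by simp
    finally show False by simp
  qed
qed

text \<open>Double counting: \<open>v\<close> is a common light neighbour of exactly those tuples
  whose entries all lie in \<open>light_in X v\<close>.\<close>

lemma sum_common_light:
  assumes "finite X" "finite J"
  shows "(\<Sum>T\<in>PiE J (\<lambda>_. X). card (common_light X J T)) = (\<Sum>v\<in>X. card (light_in X v) ^ card J)"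
proof -
  have fin: "finite (PiE J (\<lambda>_. X))" using assms by (intro finite_PiE) auto
  have "(\<Sum>T\<in>PiE J (\<lambda>_. X). card (common_light X J T)) =
      (\<Sum>T\<in>PiE J (\<lambda>_. X). \<Sum>v\<in>X. if \<forall>i\<in>J. light v (T i) then 1 else 0)"
    using assms(1) by (simp add: common_light_def sum.If_cases Int_def)
  also have "\<dots> = (\<Sum>v\<in>X. \<Sum>T\<in>PiE J (\<lambda>_. X). if \<forall>i\<in>J. light v (T i) then 1 else 0)"
    by (rule sum.swap)
  also have "\<dots> = (\<Sum>v\<in>X. card (PiE J (\<lambda>_. light_in X v)))"
  proof (rule sum.cong[OF refl])
    fix v
    have "{T \<in> PiE J (\<lambda>_. X). \<forall>i\<in>J. light v (T i)} = PiE J (\<lambda>_. light_in X v)"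
      by (auto simp: PiE_iff extensional_def light_in_def)
    then show "(\<Sum>T\<in>PiE J (\<lambda>_. X). if \<forall>i\<in>J. light v (T i) then 1 else 0) =
      card (PiE J (\<lambda>_. light_in X v))"
      using fin by (simp add: sum.If_cases Int_def)
  qed
  also have "\<dots> = (\<Sum>v\<in>X. card (light_in X v) ^ card J)"
    using assms by (simp add: card_PiE)
  finally show ?thesis .
qed

text \<open>If degeneracy occurs at \<open>i\<close> and \<open>j\<close>, then once the other
  entries are chosen, \<open>S j\<close> lies in the neighbourhood of one of the fewer than
  \<open>s * t\<close> connecting vertices of \<open>v\<close> and \<open>S i\<close>. This leaves
  at most \<open>s * t * D\<close> choices instead of \<open>card (light_in X v)\<close>; the factor
  \<open>s * s\<close> bounds the number of pairs \<open>i\<close>, \<open>j\<close>.\<close>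

lemma sum_degenerate_le:
  fixes D :: nat
  assumes XA: "X \<subseteq> A" and D: "\<And>b. b \<in> M \<Longrightarrow> card (nbhd b) \<le> D"
  shows "(\<Sum>S\<in>PiE {1..s} (\<lambda>_. X). card {v \<in> common_light X {1..s} S. degenerate v S}) \<le>
    s * s * (s * t * D) * (\<Sum>v\<in>X. card (light_in X v) ^ (s - 1))"
proof -
  let ?I = "{1..s}"
  have finX: "finite X" using XA finA finite_subset by auto
  have finN: "finite (light_in X v)" for v using finX by (simp add: light_in_def)
  have finP: "finite (PiE ?I (\<lambda>_. X))" using finX by (intro finite_PiE) auto
  let ?F = "\<lambda>v i j. {S \<in> PiE ?I (\<lambda>_. light_in X v). \<exists>b\<in>common v (S i). E (S j) b}"
  have F: "card (?F v i j) \<le> s * t * D * card (light_in X v) ^ (s - 1)"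
    if ij: "i \<in> ?I" "j \<in> ?I" "i \<noteq> j" and v: "v \<in> X" for v i j
  proof -
    define U where "U u = (\<Union>b\<in>common v u. nbhd b)" for u
    have cardU: "card (U u) \<le> s * t * D" if "light v u" for u
    proof -
      have "card (U u) \<le> (\<Sum>b\<in>common v u. card (nbhd b))" unfolding U_def by (rule card_UN_le) simp
      also have "\<dots> \<le> (\<Sum>b\<in>common v u. D)" using D by (intro sum_mono) (auto simp: common_def)
      also have "\<dots> \<le> s * t * D" using that by (auto simp: light_def intro: mult_right_mono)
      finally show ?thesis .
    qed
    have finU: "finite (U u)" for u by (simp add: U_def)
    let ?Sig = "SIGMA T:PiE (?I - {j}) (\<lambda>_. light_in X v). U (T i)"
    have finPj: "finite (PiE (?I - {j}) (\<lambda>_. light_in X v))" using finN by (intro finite_PiE) auto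
    have "card (?F v i j) \<le> card ?Sig"
    proof (rule card_inj_on_le)
      show "inj_on (\<lambda>S. (restrict S (?I - {j}), S j)) (?F v i j)"
      proof (rule inj_onI)
        fix S S' assume S: "S \<in> ?F v i j" "S' \<in> ?F v i j"
          and eq: "(restrict S (?I - {j}), S j) = (restrict S' (?I - {j}), S' j)"
        show "S = S'"
        proof (rule PiE_ext)
          show "S \<in> PiE ?I (\<lambda>_. light_in X v)" "S' \<in> PiE ?I (\<lambda>_. light_in X v)" using S by auto
          fix k assume "k \<in> ?I"
          then show "S k = S' k" using eq by (cases "k = j") (auto dest: fun_cong[where x = k])
        qed
      qed
      show "(\<lambda>S. (restrict S (?I - {j}), S j)) ` ?F v i j \<subseteq> ?Sig"
      proof (rule image_subsetI)
        fix S assume S: "S \<in> ?F v i j"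
        then have "S j \<in> A" using ij XA by (auto simp: PiE_iff light_in_def)
        then have "S j \<in> U (S i)" using S by (auto simp: U_def nbhd_def)
        moreover have "restrict S (?I - {j}) \<in> PiE (?I - {j}) (\<lambda>_. light_in X v)"
          using S by (auto simp: PiE_iff)
        ultimately show "(restrict S (?I - {j}), S j) \<in> ?Sig" using ij by auto
      qed
      show "finite ?Sig" using finPj finU by auto
    qed
    also have "\<dots> = (\<Sum>T\<in>PiE (?I - {j}) (\<lambda>_. light_in X v). card (U (T i)))"
      using finPj finU by (intro card_SigmaI) auto
    also have "\<dots> \<le> (\<Sum>T\<in>PiE (?I - {j}) (\<lambda>_. light_in X v). s * t * D)"
      using ij by (intro sum_mono cardU) (auto simp: PiE_iff light_in_def)
    also have "\<dots> = s * t * D * card (light_in X v) ^ (s - 1)"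
      using ij by (simp add: card_PiE)
    finally show ?thesis .
  qed
  have "(\<Sum>S\<in>PiE ?I (\<lambda>_. X). card {v \<in> common_light X ?I S. degenerate v S}) =
      (\<Sum>S\<in>PiE ?I (\<lambda>_. X). \<Sum>v\<in>X. if v \<in> common_light X ?I S \<and> degenerate v S then 1 else 0)"
  proof (rule sum.cong[OF refl])
    fix S
    have "{v \<in> common_light X ?I S. degenerate v S} =
      {v \<in> X. v \<in> common_light X ?I S \<and> degenerate v S}" by (auto simp: common_light_def)
    then show "card {v \<in> common_light X ?I S. degenerate v S} =
      (\<Sum>v\<in>X. if v \<in> common_light X ?I S \<and> degenerate v S then 1 else 0)"
      using finX by (simp add: sum.If_cases Int_def)
  qed
  also have "\<dots> = (\<Sum>v\<in>X. \<Sum>S\<in>PiE ?I (\<lambda>_. X). if v \<in> common_light X ?I S \<and> degenerate v S then 1 else 0)"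
    by (rule sum.swap)
  also have "\<dots> = (\<Sum>v\<in>X. card {S \<in> PiE ?I (\<lambda>_. X). v \<in> common_light X ?I S \<and> degenerate v S})"
    using finP by (simp add: sum.If_cases Int_def)
  also have "\<dots> \<le> (\<Sum>v\<in>X. s * s * (s * t * D * card (light_in X v) ^ (s - 1)))"
  proof (rule sum_mono)
    fix v assume v: "v \<in> X"
    let ?J = "{(i, j) \<in> ?I \<times> ?I. i \<noteq> j}"
    have finJ: "finite ?J" by (rule finite_subset[of _ "?I \<times> ?I"]) auto
    have "finite (PiE ?I (\<lambda>_. light_in X v))" using finN by (intro finite_PiE) auto
    then have finF: "finite (?F v i j)" for i j by (rule finite_subset[rotated]) auto
    have "card ?J \<le> card (?I \<times> ?I)" by (rule card_mono) auto
    then have cardJ: "card ?J \<le> s * s" by (simp add: card_cartesian_product)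
    have "{S \<in> PiE ?I (\<lambda>_. X). v \<in> common_light X ?I S \<and> degenerate v S} \<subseteq>
      (\<Union>x\<in>?J. ?F v (fst x) (snd x))"
    proof
      fix S assume S: "S \<in> {S \<in> PiE ?I (\<lambda>_. X). v \<in> common_light X ?I S \<and> degenerate v S}"
      then obtain i j where ij: "i \<in> ?I" "j \<in> ?I" "i \<noteq> j" "\<exists>b\<in>common v (S i). E (S j) b"
        unfolding degenerate_def by blast
      have "S \<in> PiE ?I (\<lambda>_. light_in X v)"
        using S by (auto simp: common_light_def light_in_def PiE_iff)
      then have "S \<in> ?F v i j" using ij(4) by simp
      then show "S \<in> (\<Union>x\<in>?J. ?F v (fst x) (snd x))"
        using ij(1-3) by (intro UN_I[of "(i, j)"]) auto
    qed
    then have "card {S \<in> PiE ?I (\<lambda>_. X). v \<in> common_light X ?I S \<and> degenerate v S} \<le>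
      card (\<Union>x\<in>?J. ?F v (fst x) (snd x))" using finJ finF by (intro card_mono) auto
    also have "\<dots> \<le> (\<Sum>x\<in>?J. card (?F v (fst x) (snd x)))" using finJ by (rule card_UN_le)
    also have "\<dots> \<le> (\<Sum>x\<in>?J. s * t * D * card (light_in X v) ^ (s - 1))"
      using v by (intro sum_mono F) auto
    also have "\<dots> \<le> s * s * (s * t * D * card (light_in X v) ^ (s - 1))"
      using cardJ by (simp only: sum_constant) (intro mult_right_mono, auto)
    finally show "card {S \<in> PiE ?I (\<lambda>_. X). v \<in> common_light X ?I S \<and> degenerate v S} \<le>
      s * s * (s * t * D * card (light_in X v) ^ (s - 1))" .
  qed
  also have "\<dots> = s * s * (s * t * D) * (\<Sum>v\<in>X. card (light_in X v) ^ (s - 1))"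
    by (simp add: sum_distrib_left mult_ac)
  finally show ?thesis .
qed

section \<open>The main double counting\<close>

text \<open>\<open>Q k\<close> counts vertices of \<open>X\<close> with a \<open>k\<close>-tuple of
  light neighbours. Of the total \<open>Q s\<close>, at most a quarter each goes to degenerate
  pairs, to tuples with tiny spread, and to tuples whose spread is small compared with the common
  light neighbourhood after deleting an entry. The rest is charged to rich vertices of
  \<open>M\<close> and is at most a constant times \<open>D / p * Q (s - 1)\<close>. As
  \<open>Q s \<ge> p * card X * Q (s - 1)\<close>, this contradicts \<open>big2\<close>.\<close>

lemma counting_contradiction:
  fixes p :: real and D :: nat
  assumes r: "r \<in> A" and X: "X = {v. light r v}" and p: "0 < p"
    and dense: "p * card X ^ 2 \<le> card (light_pairs X)"
    and D: "\<And>b. b \<in> M \<Longrightarrow> card (nbhd b) \<le> D"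
    and big1: "4 * \<kappa> * q \<le> p ^ s * card X"
    and big2: "16 * s ^ 2 * \<kappa> ^ 2 * q * (s * t) * D < p ^ 2 * card X"
  shows False
proof -
  let ?I = "{1..s}"
  let ?V = "common_light X"
  let ?V' = "spread X"
  define m where "m = real (card X)"
  define x where "x = p * m"
  define d where "d v = real (card (light_in X v))" for v
  define Q where "Q k = (\<Sum>v\<in>X. d v ^ k)" for k
  have XA: "X \<subseteq> A" using X by (auto simp: light_def)
  have finX: "finite X" using XA finA finite_subset by auto
  have finM0: "finite {b \<in> M. P b}" for P using finM by simp
  have kpos: "0 < \<kappa>" and qpos: "0 < q" and spos: "0 < s" and tpos: "0 < t" using s_pos t_pos by auto
  have mpos: "0 < m"
  proof -
    have "0 < real (4 * \<kappa> * q)" using kpos qpos by (simp only: of_nat_0_less_iff) simp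
    also have "\<dots> \<le> p ^ s * m" using big1 by (simp add: m_def)
    finally show ?thesis using p by (simp add: zero_less_mult_iff)
  qed
  have xpos: "0 < x" using mpos p by (simp add: x_def)
  have "(\<Sum>v\<in>X. d v) = card (light_pairs X)"
  proof -
    have "light_pairs X = (SIGMA v:X. light_in X v)" by (auto simp: light_pairs_def light_in_def)
    then have "card (light_pairs X) = (\<Sum>v\<in>X. card (light_in X v))"
      using finX by (simp add: card_SigmaI light_in_def)
    then show ?thesis by (simp add: d_def)
  qed
  then have avg: "card X * x \<le> (\<Sum>v\<in>X. d v)"
    using dense by (simp add: x_def m_def power2_eq_square mult_ac)
  have Q_Suc: "x * Q k \<le> Q (Suc k)" for k
    unfolding Q_def using finX avg xpos by (intro sum_power_Suc_ge) (auto simp: d_def)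
  have Q_ge: "m * x ^ k \<le> Q k" for k
  proof (induction k)
    case 0
    then show ?case by (simp add: Q_def m_def)
  next
    case (Suc k)
    have "m * x ^ Suc k = x * (m * x ^ k)" by simp
    also have "\<dots> \<le> x * Q k" using Suc xpos by (intro mult_left_mono) auto
    finally show ?case using Q_Suc[of k] by linarith
  qed
  have Q_pos: "0 < Q k" for k
    using Q_ge[of k] mpos xpos by (meson less_le_trans mult_pos_pos zero_less_power)
  have Q_s: "x * Q (s - 1) \<le> Q s" using Q_Suc[of "s - 1"] spos by simp
  have p_le: "p \<le> 1"
  proof -
    have "card (light_pairs X) \<le> card (X \<times> X)"
      using finX by (intro card_mono) (auto simp: light_pairs_def)
    then have "real (card (light_pairs X)) \<le> m ^ 2"
      by (simp add: m_def card_cartesian_product power2_eq_square flip: of_nat_mult)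
    then have "p * m ^ 2 \<le> 1 * m ^ 2" using dense unfolding m_def of_nat_power by linarith
    then show ?thesis using mpos by (simp only: mult_le_cancel_right_pos zero_less_power)
  qed
  have sumV: "(\<Sum>T\<in>PiE J (\<lambda>_. X). real (card (?V J T))) = Q (card J)" if "finite J" for J
    using sum_common_light[OF finX that, THEN arg_cong[of _ _ real]] by (simp add: Q_def d_def)
  have finV: "finite (?V J T)" for J T using finX by (simp add: common_light_def)
  have V'_sub: "?V' S \<subseteq> ?V ?I S" for S by (auto simp: spread_def)
  have V_split: "real (card (?V ?I S)) =
    card (?V' S) + card {v \<in> ?V ?I S. degenerate v S}" for S
  proof -
    have "?V ?I S = ?V' S \<union> {v \<in> ?V ?I S. degenerate v S}" by (auto simp: spread_def)
    then have "card (?V ?I S) = card (?V' S) + card {v \<in> ?V ?I S. degenerate v S}"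
      using card_Un_disjoint[of "?V' S" "{v \<in> ?V ?I S. degenerate v S}"] finV[of ?I S]
        finite_subset[OF V'_sub finV] by (auto simp: spread_def)
    then show ?thesis by simp
  qed
  have degen: "(\<Sum>S\<in>PiE ?I (\<lambda>_. X). real (card {v \<in> ?V ?I S. degenerate v S})) \<le> Q s / 4"
  proof -
    have "real (\<Sum>S\<in>PiE ?I (\<lambda>_. X). card {v \<in> ?V ?I S. degenerate v S}) \<le>
      real (s * s * (s * t * D) * (\<Sum>v\<in>X. card (light_in X v) ^ (s - 1)))"
      using sum_degenerate_le[OF XA D] by (simp only: of_nat_le_iff)
    also have "\<dots> = real (s ^ 2 * (s * t) * D) * Q (s - 1)"
      by (simp add: Q_def d_def power2_eq_square mult_ac)
    also have "\<dots> \<le> x / 4 * Q (s - 1)"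
    proof (intro mult_right_mono)
      \<comment> \<open>Only a weak form of \<open>big2\<close> enters here: the factor
        \<open>4 * \<kappa> ^ 2 * q\<close> and one power of \<open>p \<le> 1\<close> are given
        away.\<close>
      have "4 * (s ^ 2 * (s * t) * D) * 1 \<le> 4 * (s ^ 2 * (s * t) * D) * (4 * \<kappa> ^ 2 * q)"
        using kpos qpos by (intro mult_left_mono) (auto simp: Suc_le_eq)
      also have "\<dots> = 16 * s ^ 2 * \<kappa> ^ 2 * q * (s * t) * D" by (simp add: mult_ac)
      finally have "real (4 * (s ^ 2 * (s * t) * D) * 1) \<le> real (16 * s ^ 2 * \<kappa> ^ 2 * q * (s * t) * D)"
        by (simp only: of_nat_le_iff)
      also have "\<dots> \<le> p ^ 2 * m" using big2 by (simp add: m_def)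
      also have "\<dots> \<le> p * m" using p p_le mpos
        by (intro mult_right_mono) (auto simp: power2_eq_square mult_le_cancel_left1)
      finally show "real (s ^ 2 * (s * t) * D) \<le> x / 4" by (simp add: x_def)
    qed (use Q_pos[of "s - 1"] in simp)
    also have "\<dots> \<le> Q s / 4" using Q_s by simp
    finally show ?thesis by simp
  qed
  \<comment> \<open>With this value the \<open>s\<close> losses
    \<open>\<epsilon> * p * m * Q (s - 1)\<close>, one for each deleted entry, add up to at most
    \<open>Q s / 4\<close>.\<close>
  define \<epsilon> where "\<epsilon> = 1 / (4 * real s)"
  have epos: "0 < \<epsilon>" using spos by (simp add: \<epsilon>_def)
  define good where "good S \<longleftrightarrow> real (\<kappa> * q) \<le> card (?V' S) \<and>
    (\<forall>i\<in>?I. \<epsilon> * p * card (?V (?I - {i}) (restrict S (?I - {i}))) \<le> card (?V' S))" for S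
  \<comment> \<open>A rich \<open>b\<close> sees a share of at least
    \<open>\<epsilon> * p / \<kappa>\<close> of the common light neighbourhood; the bound
    \<open>q\<close> makes \<open>sum_nbhd_squares_le\<close> applicable.\<close>
  define rich where "rich i T b \<longleftrightarrow> q \<le> card (?V (?I - {i}) T \<inter> nbhd b) \<and>
    \<epsilon> * p * card (?V (?I - {i}) T) \<le> \<kappa> * real (card (?V (?I - {i}) T \<inter> nbhd b))" for i T b
  \<comment> \<open>The charge of the entry \<open>u\<close> completing \<open>T\<close>. Summing
    over all rich \<open>b\<close> adjacent to \<open>u\<close> avoids selecting the one that
    \<open>spread_concentrated\<close> provides.\<close>
  let ?g = "\<lambda>i T u. \<Sum>b | b \<in> M \<and> E u b \<and> rich i T b. real \<kappa> * card (?V (?I - {i}) T \<inter> nbhd b)"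
  have g_nonneg: "0 \<le> ?g i T u" for i T u by (intro sum_nonneg) auto
  \<comment> \<open>One summand on the right always suffices: the first or the second if
    \<open>S\<close> is not good, the third if it is.\<close>
  have pointwise: "real (card (?V' S)) \<le> real (\<kappa> * q) +
      (\<Sum>i\<in>?I. \<epsilon> * p * card (?V (?I - {i}) (restrict S (?I - {i})))) +
      (\<Sum>i\<in>?I. ?g i (restrict S (?I - {i})) (S i))"
    if S: "S \<in> PiE ?I (\<lambda>_. X)" for S
  proof (cases "good S")
    case False
    have nn: "0 \<le> \<epsilon> * p * card (?V (?I - {i}) (restrict S (?I - {i})))" for i
      using epos p by simp
    from False consider "real (card (?V' S)) < \<kappa> * q"
      | i where "i \<in> ?I" "card (?V' S) < \<epsilon> * p * card (?V (?I - {i}) (restrict S (?I - {i})))"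
      by (auto simp: good_def not_le)
    then show ?thesis
    proof cases
      case 1
      moreover have "0 \<le> (\<Sum>i\<in>?I. \<epsilon> * p * card (?V (?I - {i}) (restrict S (?I - {i}))))"
        using nn by (intro sum_nonneg) auto
      moreover have "0 \<le> (\<Sum>i\<in>?I. ?g i (restrict S (?I - {i})) (S i))"
        using g_nonneg by (intro sum_nonneg) auto
      ultimately show ?thesis by linarith
    next
      case (2 i)
      have "\<epsilon> * p * card (?V (?I - {i}) (restrict S (?I - {i}))) \<le>
        (\<Sum>i\<in>?I. \<epsilon> * p * card (?V (?I - {i}) (restrict S (?I - {i}))))"
        using 2(1) nn by (intro member_le_sum) auto
      moreover have "0 \<le> (\<Sum>i\<in>?I. ?g i (restrict S (?I - {i})) (S i))"
        using g_nonneg by (intro sum_nonneg) auto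
      moreover have "0 \<le> real (\<kappa> * q)" by simp
      ultimately show ?thesis using 2(2) by linarith
    qed
  next
    case True
    have "0 < real (\<kappa> * q)" using kpos qpos by (simp only: of_nat_0_less_iff) simp
    also have "\<dots> \<le> card (?V' S)" using True unfolding good_def by blast
    finally have "0 < card (?V' S)" by simp
    then have ne: "?V' S \<noteq> {}" by force
    have SX: "S i \<in> X" if "i \<in> ?I" for i using S that by (auto simp: PiE_iff)
    obtain i b where ib: "i \<in> ?I" "b \<in> M" "E (S i) b"
      "card (?V' S) \<le> \<kappa> * card (?V' S \<inter> nbhd b)"
      using spread_concentrated[OF r X SX ne] by blast
    let ?T = "restrict S (?I - {i})"
    let ?c = "card (?V (?I - {i}) ?T \<inter> nbhd b)"
    have "?V' S \<inter> nbhd b \<subseteq> ?V (?I - {i}) ?T \<inter> nbhd b"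
      by (auto simp: spread_def common_light_def)
    then have "card (?V' S \<inter> nbhd b) \<le> ?c" by (intro card_mono) auto
    then have "\<kappa> * card (?V' S \<inter> nbhd b) \<le> \<kappa> * ?c" by (intro mult_left_mono) auto
    with ib(4) have le: "card (?V' S) \<le> \<kappa> * ?c" by linarith
    then have le': "real (card (?V' S)) \<le> real \<kappa> * ?c"
      by (simp only: of_nat_mult[symmetric] of_nat_le_iff)
    have "rich i ?T b"
      unfolding rich_def
    proof
      have "\<kappa> * q \<le> card (?V' S)" using True by (simp only: good_def of_nat_le_iff)
      then have "\<kappa> * q \<le> \<kappa> * ?c" using le by linarith
      then show "q \<le> ?c" using kpos by (simp only: mult_le_cancel1)
      have "\<epsilon> * p * card (?V (?I - {i}) ?T) \<le> card (?V' S)"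
        using True ib(1) unfolding good_def by blast
      also note le'
      finally show "\<epsilon> * p * card (?V (?I - {i}) ?T) \<le> \<kappa> * real ?c" .
    qed
    then have "real \<kappa> * ?c \<le> ?g i ?T (S i)"
      using ib finM by (intro member_le_sum[of b "{b. b \<in> M \<and> E (S i) b \<and> rich i ?T b}"
        "\<lambda>b. real \<kappa> * card (?V (?I - {i}) ?T \<inter> nbhd b)"]) auto
    also have "\<dots> \<le> (\<Sum>i\<in>?I. ?g i (restrict S (?I - {i})) (S i))"
      using ib(1) g_nonneg by (intro member_le_sum[of i ?I]) auto
    finally have "real (card (?V' S)) \<le> (\<Sum>i\<in>?I. ?g i (restrict S (?I - {i})) (S i))"
      using le' by linarith
    moreover have "0 \<le> (\<Sum>i\<in>?I. \<epsilon> * p * card (?V (?I - {i}) (restrict S (?I - {i}))))"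
      using epos p by (intro sum_nonneg) auto
    moreover have "0 \<le> real (\<kappa> * q)" by simp
    ultimately show ?thesis by linarith
  qed
  \<comment> \<open>Each rich \<open>b\<close> is charged by at most \<open>D\<close> vertices
    \<open>u\<close>. Richness turns the sum of degrees into a sum of squares, which is bounded by
    \<open>sum_nbhd_squares_le\<close> and the trivial count of ordered pairs.\<close>
  have rich_sum: "(\<Sum>u\<in>X. ?g i T u) \<le>
      real \<kappa> * D * (real (q * (s * t)) * \<kappa> / (\<epsilon> * p)) * card (?V (?I - {i}) T)"
    if "i \<in> ?I" for i T
  proof -
    let ?W = "?V (?I - {i}) T"
    let ?R = "{b \<in> M. rich i T b}"
    let ?c = "\<lambda>b. real (card (?W \<inter> nbhd b))"
    have WX: "?W \<subseteq> X" by (auto simp: common_light_def)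
    have finW: "finite ?W" by (rule finV)
    have "(\<Sum>u\<in>X. ?g i T u) = (\<Sum>u\<in>X. \<Sum>b\<in>?R. if E u b then real \<kappa> * ?c b else 0)"
    proof (rule sum.cong[OF refl])
      fix u
      have "{b. b \<in> M \<and> E u b \<and> rich i T b} = {b \<in> ?R. E u b}" by auto
      then show "?g i T u = (\<Sum>b\<in>?R. if E u b then real \<kappa> * ?c b else 0)"
        using finM by (simp only: sum.inter_filter[OF finM0])
    qed
    also have "\<dots> = (\<Sum>b\<in>?R. \<Sum>u\<in>X. if E u b then real \<kappa> * ?c b else 0)" by (rule sum.swap)
    also have "\<dots> = (\<Sum>b\<in>?R. card (X \<inter> {u. E u b}) * (real \<kappa> * ?c b))"
      using finX by (simp add: sum.If_cases)
    also have "\<dots> \<le> (\<Sum>b\<in>?R. D * (real \<kappa> * ?c b))"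
    proof (intro sum_mono mult_right_mono)
      fix b assume b: "b \<in> ?R"
      have "card (X \<inter> {u. E u b}) \<le> card (nbhd b)"
        using XA by (intro card_mono fin_nbhd) (auto simp: nbhd_def)
      then have "card (X \<inter> {u. E u b}) \<le> D" using D[of b] b by simp
      then show "real (card (X \<inter> {u. E u b})) \<le> real D" by simp
    qed auto
    also have "\<dots> = real \<kappa> * D * (\<Sum>b\<in>?R. ?c b)" by (simp add: sum_distrib_left mult_ac)
    finally have 1: "(\<Sum>u\<in>X. ?g i T u) \<le> real \<kappa> * D * (\<Sum>b\<in>?R. ?c b)" .
    have "(\<Sum>b\<in>?R. ?c b) \<le> real (q * (s * t)) * \<kappa> / (\<epsilon> * p) * card ?W"
    proof (cases "?W = {}")
      case False
      then have Wpos: "0 < real (card ?W)" using finW by (simp add: card_gt_0_iff)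
      have "card (light_pairs ?W) \<le> card (?W \<times> ?W)"
        using finW by (intro card_mono) (auto simp: light_pairs_def)
      then have lp: "card (light_pairs ?W) \<le> card ?W ^ 2"
        by (simp add: card_cartesian_product power2_eq_square)
      have "(\<Sum>b\<in>?R. card (?W \<inter> nbhd b) ^ 2) \<le> q * (s * t) * card (light_pairs ?W)"
        using WX XA by (intro sum_nbhd_squares_le) (auto simp: rich_def)
      also have "\<dots> \<le> q * (s * t) * card ?W ^ 2" using lp by (intro mult_left_mono) auto
      finally have "real (\<Sum>b\<in>?R. card (?W \<inter> nbhd b) ^ 2) \<le> real (q * (s * t) * card ?W ^ 2)"
        by (simp only: of_nat_le_iff)
      then have sq: "(\<Sum>b\<in>?R. ?c b ^ 2) \<le> real (q * (s * t)) * card ?W ^ 2" by simp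
      have "\<epsilon> * p * card ?W * (\<Sum>b\<in>?R. ?c b) = (\<Sum>b\<in>?R. (\<epsilon> * p * card ?W) * ?c b)"
        by (rule sum_distrib_left)
      also have "\<dots> \<le> (\<Sum>b\<in>?R. (\<kappa> * ?c b) * ?c b)"
        by (intro sum_mono mult_right_mono) (auto simp: rich_def)
      also have "\<dots> = \<kappa> * (\<Sum>b\<in>?R. ?c b ^ 2)" by (simp add: sum_distrib_left power2_eq_square mult_ac)
      also have "\<dots> \<le> \<kappa> * (real (q * (s * t)) * card ?W ^ 2)" using sq by (intro mult_left_mono) auto
      also have "\<dots> = (real (q * (s * t)) * \<kappa> * card ?W) * card ?W" by (simp add: power2_eq_square mult_ac)
      finally have "(\<epsilon> * p * (\<Sum>b\<in>?R. ?c b)) * card ?W \<le> (real (q * (s * t)) * \<kappa> * card ?W) * card ?W"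
        by (simp add: mult_ac)
      then have "\<epsilon> * p * (\<Sum>b\<in>?R. ?c b) \<le> real (q * (s * t)) * \<kappa> * card ?W"
        using Wpos by (simp only: mult_le_cancel_right_pos)
      then show ?thesis using epos p by (simp add: field_simps)
    next
      case True
      then show ?thesis by simp
    qed
    then have "real \<kappa> * D * (\<Sum>b\<in>?R. ?c b) \<le>
        real \<kappa> * D * (real (q * (s * t)) * \<kappa> / (\<epsilon> * p) * card ?W)"
      by (rule mult_left_mono) simp
    with 1 show ?thesis by (simp only: mult.assoc)
  qed
  have "Q s = (\<Sum>S\<in>PiE ?I (\<lambda>_. X). real (card (?V ?I S)))" using sumV[of ?I] by simp
  also have "\<dots> = (\<Sum>S\<in>PiE ?I (\<lambda>_. X). real (card (?V' S))) +
      (\<Sum>S\<in>PiE ?I (\<lambda>_. X). real (card {v \<in> ?V ?I S. degenerate v S}))"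
    by (simp only: V_split of_nat_add sum.distrib)
  also have "\<dots> \<le> (\<Sum>S\<in>PiE ?I (\<lambda>_. X). real (card (?V' S))) + Q s / 4" using degen by simp
  also have "(\<Sum>S\<in>PiE ?I (\<lambda>_. X). real (card (?V' S))) \<le>
      (\<Sum>S\<in>PiE ?I (\<lambda>_. X). real (\<kappa> * q) +
      (\<Sum>i\<in>?I. \<epsilon> * p * card (?V (?I - {i}) (restrict S (?I - {i})))) +
      (\<Sum>i\<in>?I. ?g i (restrict S (?I - {i})) (S i)))"
    by (rule sum_mono) (rule pointwise)
  also have "\<dots> = (\<Sum>S\<in>PiE ?I (\<lambda>_. X). real (\<kappa> * q)) +
      (\<Sum>i\<in>?I. \<Sum>S\<in>PiE ?I (\<lambda>_. X). \<epsilon> * p * card (?V (?I - {i}) (restrict S (?I - {i})))) +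
      (\<Sum>i\<in>?I. \<Sum>S\<in>PiE ?I (\<lambda>_. X). ?g i (restrict S (?I - {i})) (S i))"
    by (simp only: sum.distrib sum.swap[of _ ?I "PiE ?I (\<lambda>_. X)"])
  \<comment> \<open>There are \<open>m ^ s\<close> tuples, and
    \<open>Q s \<ge> m * x ^ s = p ^ s * m * m ^ s\<close>; hence the form of
    \<open>big1\<close>.\<close>
  also have "(\<Sum>S\<in>PiE ?I (\<lambda>_. X). real (\<kappa> * q)) \<le> Q s / 4"
  proof -
    have "(\<Sum>S\<in>PiE ?I (\<lambda>_. X). real (\<kappa> * q)) = m ^ s * (real (4 * \<kappa> * q) / 4)"
      by (simp add: card_PiE m_def)
    also have "\<dots> \<le> m ^ s * ((p ^ s * m) / 4)"
      using big1 mpos by (intro mult_left_mono divide_right_mono) (auto simp: m_def)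
    also have "\<dots> = (m * x ^ s) / 4" by (simp add: x_def power_mult_distrib)
    also have "\<dots> \<le> Q s / 4" using Q_ge[of s] by simp
    finally show ?thesis .
  qed
  also have "(\<Sum>i\<in>?I. \<Sum>S\<in>PiE ?I (\<lambda>_. X). \<epsilon> * p * card (?V (?I - {i}) (restrict S (?I - {i})))) \<le> Q s / 4"
  proof -
    have "(\<Sum>S\<in>PiE ?I (\<lambda>_. X). \<epsilon> * p * card (?V (?I - {i}) (restrict S (?I - {i})))) =
        \<epsilon> * p * m * Q (s - 1)" if i: "i \<in> ?I" for i
    proof -
      have "(\<Sum>S\<in>PiE ?I (\<lambda>_. X). \<epsilon> * p * card (?V (?I - {i}) (restrict S (?I - {i})))) =
        (\<Sum>T\<in>PiE (?I - {i}) (\<lambda>_. X). \<Sum>u\<in>X. \<epsilon> * p * card (?V (?I - {i}) T))"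
        using sum_PiE_split[OF i _ finX, of "\<lambda>T u. \<epsilon> * p * card (?V (?I - {i}) T)"] by simp
      also have "\<dots> = \<epsilon> * p * m * (\<Sum>T\<in>PiE (?I - {i}) (\<lambda>_. X). real (card (?V (?I - {i}) T)))"
        by (simp add: m_def sum_distrib_left mult_ac)
      also have "\<dots> = \<epsilon> * p * m * Q (s - 1)" using i by (subst sumV) auto
      finally show ?thesis .
    qed
    then have "(\<Sum>i\<in>?I. \<Sum>S\<in>PiE ?I (\<lambda>_. X). \<epsilon> * p * card (?V (?I - {i}) (restrict S (?I - {i})))) =
      s * (\<epsilon> * p * m * Q (s - 1))" by simp
    also have "\<dots> = x * Q (s - 1) / 4" using spos by (simp add: \<epsilon>_def x_def)
    also have "\<dots> \<le> Q s / 4" using Q_s by simp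
    finally show ?thesis .
  qed
  also have "(\<Sum>i\<in>?I. \<Sum>S\<in>PiE ?I (\<lambda>_. X). ?g i (restrict S (?I - {i})) (S i)) \<le>
      s * (real \<kappa> * D * (real (q * (s * t)) * \<kappa> / (\<epsilon> * p)) * Q (s - 1))"
  proof -
    have "(\<Sum>S\<in>PiE ?I (\<lambda>_. X). ?g i (restrict S (?I - {i})) (S i)) \<le>
        real \<kappa> * D * (real (q * (s * t)) * \<kappa> / (\<epsilon> * p)) * Q (s - 1)" if i: "i \<in> ?I" for i
    proof -
      have "(\<Sum>S\<in>PiE ?I (\<lambda>_. X). ?g i (restrict S (?I - {i})) (S i)) =
        (\<Sum>T\<in>PiE (?I - {i}) (\<lambda>_. X). \<Sum>u\<in>X. ?g i T u)"
        by (rule sum_PiE_split[OF i _ finX, of "?g i"]) simp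
      also have "\<dots> \<le> (\<Sum>T\<in>PiE (?I - {i}) (\<lambda>_. X).
          real \<kappa> * D * (real (q * (s * t)) * \<kappa> / (\<epsilon> * p)) * card (?V (?I - {i}) T))"
        by (rule sum_mono) (rule rich_sum[OF i])
      also have "\<dots> = real \<kappa> * D * (real (q * (s * t)) * \<kappa> / (\<epsilon> * p)) *
          (\<Sum>T\<in>PiE (?I - {i}) (\<lambda>_. X). real (card (?V (?I - {i}) T)))"
        by (rule sum_distrib_left[symmetric])
      also have "(\<Sum>T\<in>PiE (?I - {i}) (\<lambda>_. X). real (card (?V (?I - {i}) T))) = Q (s - 1)"
        using i by (subst sumV) auto
      finally show ?thesis .
    qed
    from sum_mono[of ?I, OF this] show ?thesis by simp
  qed
  finally have "Q s / 4 \<le> s * (real \<kappa> * D * (real (q * (s * t)) * \<kappa> / (\<epsilon> * p)) * Q (s - 1))"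
    by simp
  then have "x / 4 * Q (s - 1) \<le> (s * (real \<kappa> * D * (real (q * (s * t)) * \<kappa> / (\<epsilon> * p)))) * Q (s - 1)"
    using Q_s by (simp only: mult_ac times_divide_eq_right times_divide_eq_left)
  then have "x / 4 \<le> s * (real \<kappa> * D * (real (q * (s * t)) * \<kappa> / (\<epsilon> * p)))"
    using Q_pos[of "s - 1"] by (simp only: mult_le_cancel_right_pos)
  \<comment> \<open>Multiplying by \<open>4 * p\<close> and inserting
    \<open>1 / \<epsilon> = 4 * s\<close> produces the constant of \<open>big2\<close>.\<close>
  then have "p * m * p \<le> 4 * s * (real \<kappa> * D * (real (q * (s * t)) * \<kappa> * (4 * s)))"
    using p spos by (simp add: \<epsilon>_def x_def field_simps)
  also have "\<dots> = real (16 * s ^ 2 * \<kappa> ^ 2 * q * (s * t) * D)"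
    by (simp add: power2_eq_square mult_ac)
  finally show False using big2 by (simp add: m_def power2_eq_square mult_ac)
qed

section \<open>Choice of the root and reduction to inequalities between \<open>e\<close> and
  \<open>n\<close>\<close>

text \<open>\<open>light_pairs_lower_bound\<close> is applied twice: to \<open>A\<close>, giving a
  vertex \<open>r\<close> with many light neighbours, and to their set \<open>X\<close>, for which
  \<open>mindeg\<close> provides the edges. The hypotheses \<open>e1\<close> and \<open>e2\<close>
  permit the two applications; \<open>e3\<close> and \<open>e4\<close> yield \<open>big1\<close> and
  \<open>big2\<close> in the worst case \<open>card M = n\<close>.\<close>

lemma few_edges:
  fixes e n c :: real and D :: nat
  defines "c \<equiv> real (4 * q * (s * t))"
  assumes e: "0 < e" "e \<le> (\<Sum>b\<in>M. card (nbhd b))"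
    and n: "0 < n" "card A \<le> n" "card M \<le> n"
    and mindeg: "\<And>v. v \<in> A \<Longrightarrow> e / n \<le> card {b \<in> M. E v b}"
    and D: "\<And>b. b \<in> M \<Longrightarrow> card (nbhd b) \<le> D" "D * card M \<le> 4 * e"
    and e1: "2 * q * n \<le> e"
    and e2: "c * (2 * q) * n ^ 4 \<le> e ^ 3"
    and e3: "4 * \<kappa> * q * c ^ (s + 1) * n ^ (3 * s + 2) \<le> e ^ (2 * s + 2)"
    and e4: "4 * (16 * s ^ 2 * \<kappa> ^ 2 * q * (s * t)) * c ^ 3 * n ^ 7 < e ^ 5"
  shows False
proof -
  define \<mu> where "\<mu> = real (card M)"
  have cpos: "0 < c" using s_pos t_pos by (simp add: c_def)
  have \<mu>: "0 < \<mu>" "\<mu> \<le> n"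
  proof -
    have "M \<noteq> {}" using e by auto
    then show "0 < \<mu>" using finM by (simp add: \<mu>_def card_gt_0_iff)
    show "\<mu> \<le> n" using n by (simp add: \<mu>_def)
  qed
  have A_nbhd: "A \<inter> nbhd b = nbhd b" for b by (auto simp: nbhd_def)
  have "real (2 * q * card M) \<le> 2 * q * n"
    using n(3) by simp
  also have "\<dots> \<le> (\<Sum>b\<in>M. card (nbhd b))" using e1 e(2) by linarith
  finally have "2 * q * card M \<le> (\<Sum>b\<in>M. card (A \<inter> nbhd b))" by (simp only: of_nat_le_iff A_nbhd)
  from light_pairs_lower_bound[OF subset_refl this]
  have "real ((\<Sum>b\<in>M. card (nbhd b)) ^ 2) \<le> real (4 * q * (s * t) * card M * card (light_pairs A))"
    by (simp only: of_nat_le_iff A_nbhd)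
  moreover have "e ^ 2 \<le> real (\<Sum>b\<in>M. card (nbhd b)) ^ 2" using e by (intro power_mono) auto
  ultimately have LA: "e ^ 2 \<le> c * \<mu> * card (light_pairs A)" by (simp add: c_def \<mu>_def)
  have LPA: "card (light_pairs A) = (\<Sum>v\<in>A. card (light_in A v))"
  proof -
    have "light_pairs A = (SIGMA v:A. light_in A v)" by (auto simp: light_pairs_def light_in_def)
    then show ?thesis using finA by (simp add: card_SigmaI light_in_def)
  qed
  have "\<exists>r\<in>A. card (light_pairs A) \<le> card (light_in A r) * card A"
  proof (rule ccontr)
    assume contr: "\<not> ?thesis"
    have "A \<noteq> {}"
    proof
      assume "A = {}"
      then have "card (light_pairs A) = 0" unfolding LPA by simp
      then show False using LA e(1) by simp
    qed
    then have "(\<Sum>v\<in>A. card (light_in A v) * card A) < (\<Sum>v\<in>A. card (light_pairs A))"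
      using contr finA by (intro sum_strict_mono) auto
    then show False by (simp add: LPA sum_distrib_right[symmetric])
  qed
  then obtain r where r: "r \<in> A" "card (light_pairs A) \<le> card (light_in A r) * card A" by blast
  define X where "X = {v. light r v}"
  have X_eq: "X = light_in A r" by (auto simp: X_def light_in_def light_def)
  have XA: "X \<subseteq> A" by (auto simp: X_def light_def)
  have finX: "finite X" using XA finA finite_subset by auto
  define m where "m = real (card X)"
  have m_ge: "e ^ 2 / (c * \<mu> * n) \<le> m"
  proof -
    have "real (card (light_pairs A)) \<le> m * card A"
      using r(2) by (simp only: m_def X_eq of_nat_mult[symmetric] of_nat_le_iff)
    also have "\<dots> \<le> m * n" using n by (intro mult_left_mono) (auto simp: m_def)
    finally have "c * \<mu> * card (light_pairs A) \<le> c * \<mu> * (m * n)"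
      using cpos \<mu> by (intro mult_left_mono) auto
    with LA have "e ^ 2 \<le> m * (c * \<mu> * n)" by (simp add: mult_ac)
    then show ?thesis using cpos \<mu> n by (simp add: pos_divide_le_eq)
  qed
  define eX where "eX = (\<Sum>b\<in>M. card (X \<inter> nbhd b))"
  have eX_ge: "m * (e / n) \<le> eX"
  proof -
    have "eX = (\<Sum>b\<in>M. \<Sum>v\<in>X. if E v b then 1 else 0)"
    proof -
      have "X \<inter> nbhd b = {v \<in> X. E v b}" for b using XA by (auto simp: nbhd_def)
      then show ?thesis using finX by (simp add: eX_def sum.If_cases Int_def)
    qed
    also have "\<dots> = (\<Sum>v\<in>X. card {b \<in> M. E v b})"
      by (subst sum.swap) (use finM in \<open>simp add: sum.If_cases Int_def\<close>)
    finally have "real eX = (\<Sum>v\<in>X. real (card {b \<in> M. E v b}))" by simp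
    also have "\<dots> \<ge> (\<Sum>v\<in>X. e / n)" using mindeg XA by (intro sum_mono) auto
    finally show ?thesis by (simp add: m_def)
  qed
  have "real (2 * q * card M) \<le> eX"
  proof -
    have "2 * q * \<mu> * (c * \<mu> * n ^ 2) = c * (2 * q) * (\<mu> ^ 2 * n ^ 2)"
      by (simp add: power2_eq_square mult_ac)
    also have "\<dots> \<le> c * (2 * q) * (n ^ 2 * n ^ 2)"
      using \<mu> cpos by (intro mult_left_mono mult_right_mono power_mono) auto
    also have "\<dots> = c * (2 * q) * n ^ 4" by (simp flip: power_add)
    also have "\<dots> \<le> e ^ 3" by (rule e2)
    finally have "2 * q * \<mu> \<le> e ^ 3 / (c * \<mu> * n ^ 2)"
      using cpos \<mu> n by (subst pos_le_divide_eq) auto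
    also have "\<dots> = e ^ 2 / (c * \<mu> * n) * (e / n)" by (simp add: power2_eq_square power3_eq_cube)
    also have "\<dots> \<le> m * (e / n)" using m_ge e n by (intro mult_right_mono) auto
    also note eX_ge
    finally show ?thesis by (simp add: \<mu>_def)
  qed
  then have "2 * q * card M \<le> eX" by (simp only: of_nat_le_iff)
  from light_pairs_lower_bound[OF XA this[unfolded eX_def]]
  have "real (eX ^ 2) \<le> real (4 * q * (s * t) * card M * card (light_pairs X))"
    unfolding eX_def by (simp only: of_nat_le_iff)
  moreover have "(m * (e / n)) ^ 2 \<le> real eX ^ 2"
    using eX_ge e n by (intro power_mono) (auto simp: m_def)
  ultimately have LX: "(m * (e / n)) ^ 2 \<le> c * \<mu> * card (light_pairs X)" by (simp add: c_def \<mu>_def)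
  \<comment> \<open>The density of light pairs that the second application guarantees when
    \<open>X\<close> sends at least \<open>m * (e / n)\<close> edges to \<open>M\<close>.\<close>
  define p where "p = e ^ 2 / (c * \<mu> * n ^ 2)"
  have ppos: "0 < p" using e cpos \<mu> n by (simp add: p_def)
  have dense: "p * card X ^ 2 \<le> card (light_pairs X)"
  proof -
    have "p * m ^ 2 = (m * (e / n)) ^ 2 / (c * \<mu>)"
      by (simp add: p_def power_mult_distrib power_divide mult_ac)
    also have "\<dots> \<le> card (light_pairs X)"
      using LX cpos \<mu> by (subst pos_divide_le_eq) (auto simp: mult_ac)
    finally show ?thesis by (simp add: m_def)
  qed
  have big1: "4 * \<kappa> * q \<le> p ^ s * card X"
  proof -
    have eq: "p ^ s * (e ^ 2 / (c * \<mu> * n)) =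
        e ^ (2 * s + 2) / (c ^ (s + 1) * \<mu> ^ (s + 1) * n ^ (2 * s + 1))"
      by (simp add: p_def power_divide power_mult_distrib power_add power_mult mult_ac
          power_even_eq flip: power_mult) (simp add: power2_eq_square)
    have "real (4 * \<kappa> * q) * (c ^ (s + 1) * \<mu> ^ (s + 1) * n ^ (2 * s + 1)) \<le>
        real (4 * \<kappa> * q) * (c ^ (s + 1) * n ^ (s + 1) * n ^ (2 * s + 1))"
      using \<mu> cpos n by (intro mult_left_mono mult_right_mono power_mono) auto
    also have "\<dots> = 4 * \<kappa> * q * c ^ (s + 1) * (n ^ (s + 1) * n ^ (2 * s + 1))" by simp
    also have "n ^ (s + 1) * n ^ (2 * s + 1) = n ^ (3 * s + 2)"
      by (subst power_add[symmetric]) (rule arg_cong[of _ _ "(^) n"], simp)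
    also note e3
    finally have "real (4 * \<kappa> * q) \<le> e ^ (2 * s + 2) / (c ^ (s + 1) * \<mu> ^ (s + 1) * n ^ (2 * s + 1))"
      using cpos \<mu> n by (subst pos_le_divide_eq) auto
    also have "\<dots> = p ^ s * (e ^ 2 / (c * \<mu> * n))" by (rule eq[symmetric])
    also have "\<dots> \<le> p ^ s * m" using m_ge ppos by (intro mult_left_mono) auto
    finally show ?thesis by (simp add: m_def)
  qed
  have big2: "16 * s ^ 2 * \<kappa> ^ 2 * q * (s * t) * D < p ^ 2 * card X"
  proof -
    define K where "K = real (16 * s ^ 2 * \<kappa> ^ 2 * q * (s * t))"
    have K: "0 \<le> K" by (simp add: K_def)
    have "4 * K * c ^ 3 * (\<mu> ^ 2 * n ^ 5) \<le> 4 * K * c ^ 3 * (n ^ 2 * n ^ 5)"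
      using \<mu> cpos n K by (intro mult_left_mono mult_right_mono power_mono) auto
    also have "\<dots> = 4 * K * c ^ 3 * n ^ 7" by (simp flip: power_add)
    also have "\<dots> < e ^ 5" using e4 by (simp add: K_def)
    finally have *: "4 * K * c ^ 3 * (\<mu> ^ 2 * n ^ 5) < e ^ 5" .
    \<comment> \<open>Bounding \<open>D\<close> by the average cancels one \<open>\<mu>\<close> from
      the denominator of \<open>p ^ 2 * m\<close>; what remains, \<open>\<mu> ^ 2 * n ^ 5\<close>,
      is at most \<open>n ^ 7\<close>.\<close>
    have "D \<le> 4 * e / \<mu>" using D(2) \<mu> by (simp add: pos_le_divide_eq \<mu>_def)
    then have "K * D \<le> K * (4 * e / \<mu>)" using K by (intro mult_left_mono) auto
    also have "\<dots> = e * (4 * K * c ^ 3 * (\<mu> ^ 2 * n ^ 5)) / (c ^ 3 * \<mu> ^ 3 * n ^ 5)"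
      using cpos \<mu> n by (simp add: field_simps power2_eq_square power3_eq_cube)
    also have "\<dots> < e * e ^ 5 / (c ^ 3 * \<mu> ^ 3 * n ^ 5)"
      using * e cpos \<mu> n by (intro divide_strict_right_mono mult_strict_left_mono) auto
    also have "\<dots> = p ^ 2 * (e ^ 2 / (c * \<mu> * n))"
      by (simp add: p_def power_divide power_mult_distrib eval_nat_numeral mult_ac)
    also have "\<dots> \<le> p ^ 2 * m" using m_ge by (intro mult_left_mono) auto
    finally show ?thesis by (simp add: K_def m_def)
  qed
  show False using counting_contradiction[OF r(1) X_def ppos _ D(1)] dense big1 big2 by simp
qed

end

section \<open>From a graph to a bipartite piece with balanced degrees; embedding a member of the
  family\<close>

text \<open>Edges avoiding \<open>x\<close> are cut alike by \<open>A\<close> and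
  \<open>insert x A\<close>, and every edge at \<open>x\<close> is cut by one of the two, so the
  better choice cuts at least half.\<close>

lemma exists_large_cut:
  assumes "finite V" "\<And>e. e \<in> Es \<Longrightarrow> e \<subseteq> V \<and> card e = 2"
  shows "\<exists>A\<subseteq>V. card Es \<le> 2 * card {e \<in> Es. card (e \<inter> A) = 1}"
  using assms
proof (induction V arbitrary: Es rule: finite_induct)
  case empty
  then have "Es = {}" by (metis card.empty equals0I subset_empty zero_neq_numeral)
  then show ?case by simp
next
  case (insert x V)
  let ?E0 = "{e \<in> Es. x \<notin> e}" and ?E1 = "{e \<in> Es. x \<in> e}"
  have "\<exists>A\<subseteq>V. card ?E0 \<le> 2 * card {e \<in> ?E0. card (e \<inter> A) = 1}"
    by (rule insert.IH) (use insert.prems in auto)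
  then obtain A where A: "A \<subseteq> V" "card ?E0 \<le> 2 * card {e \<in> ?E0. card (e \<inter> A) = 1}" by blast
  have "Es \<subseteq> Pow (insert x V)" using insert.prems by blast
  then have fin: "finite Es" using insert.hyps finite_subset by blast
  let ?cut = "\<lambda>F A. {e \<in> F. card (e \<inter> A) = 1}"
  have xA: "x \<notin> A" using A insert.hyps by auto
  have E1: "card ((e \<inter> A)) = 1 \<or> card (e \<inter> insert x A) = 1" if e: "e \<in> ?E1" for e
  proof -
    have "card e = 2" using insert.prems e by auto
    then obtain u v where "e = {u, v}" "u \<noteq> v" by (auto simp: card_2_iff)
    then obtain w where w: "e = {x, w}" "w \<noteq> x" using e by auto
    show ?thesis
    proof (cases "w \<in> A")
      case True
      then have "e \<inter> A = {w}" using w xA by auto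
      then show ?thesis by simp
    next
      case False
      then have "e \<inter> insert x A = {x}" using w by auto
      then show ?thesis by simp
    qed
  qed
  have split: "card (?cut Es A') = card (?cut ?E0 A') + card (?cut ?E1 A')" for A'
    using fin by (subst card_Un_disjoint[symmetric]) (auto intro: arg_cong[of _ _ card])
  have "?cut ?E0 (insert x A) = ?cut ?E0 A" by auto
  moreover have "card ?E1 \<le> card (?cut ?E1 A) + card (?cut ?E1 (insert x A))"
  proof -
    have "?E1 \<subseteq> ?cut ?E1 A \<union> ?cut ?E1 (insert x A)" using E1 by blast
    then have "card ?E1 \<le> card (?cut ?E1 A \<union> ?cut ?E1 (insert x A))"
      using fin by (intro card_mono) auto
    also have "\<dots> \<le> card (?cut ?E1 A) + card (?cut ?E1 (insert x A))" by (rule card_Un_le)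
    finally show ?thesis .
  qed
  moreover have "card Es = card ?E0 + card ?E1"
    using fin by (subst card_Un_disjoint[symmetric]) (auto intro: arg_cong[of _ _ card])
  ultimately have "card Es \<le> card (?cut Es A) + card (?cut Es (insert x A))"
    using A(2) split[of A] split[of "insert x A"] by simp
  then consider "card Es \<le> 2 * card (?cut Es A)" | "card Es \<le> 2 * card (?cut Es (insert x A))"
    by linarith
  then show ?case
  proof cases
    case 1
    then show ?thesis using A(1) by (intro exI[of _ A]) auto
  next
    case 2
    then show ?thesis using A(1) by (intro exI[of _ "insert x A"]) auto
  qed
qed

text \<open>Pigeonhole over the at most \<open>1 + log 2 n\<close> dyadic ranges that positive
  values can meet. In the class found, maximum and average differ by a factor of at most
  two.\<close>

lemma exists_dyadic_class:
  fixes f :: "'a \<Rightarrow> nat"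
  assumes "finite V" "1 \<le> n" "\<And>b. b \<in> V \<Longrightarrow> f b \<le> n"
  shows "\<exists>j. (\<Sum>b\<in>V. f b) \<le>
    (1 + log 2 n) * (\<Sum>b | b \<in> V \<and> 2 ^ j \<le> f b \<and> f b < 2 ^ (j + 1). f b)"
proof (rule ccontr)
  let ?V = "\<lambda>j. {b \<in> V. 2 ^ j \<le> f b \<and> f b < 2 ^ (j + 1)}"
  assume contr: "\<not> ?thesis"
  define L where "L = Suc (nat \<lfloor>log 2 n\<rfloor>)"
  have log0: "0 \<le> log 2 n" using assms(2) by simp
  then have L: "real L \<le> 1 + log 2 n" by (simp add: L_def)
  have "(\<Sum>b\<in>V. f b) \<le> (\<Sum>b\<in>V. \<Sum>j<L. if 2 ^ j \<le> f b \<and> f b < 2 ^ (j + 1) then f b else 0)"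
  proof (rule sum_mono)
    fix b assume b: "b \<in> V"
    show "f b \<le> (\<Sum>j<L. if 2 ^ j \<le> f b \<and> f b < 2 ^ (j + 1) then f b else 0)"
    proof (cases "f b = 0")
      case False
      then obtain j where j: "2 ^ j \<le> f b" "f b < 2 ^ (j + 1)"
        using ex_power_ivl1[of 2 "f b"] by auto
      have "2 ^ j \<le> n" using j assms(3)[OF b] by simp
      then have "real j \<le> log 2 n" using le_log2_of_power by blast
      then have "j < L" by (simp add: L_def less_Suc_eq_le le_nat_floor)
      then show ?thesis
        using j member_le_sum[of j "{..<L}" "\<lambda>j. if 2 ^ j \<le> f b \<and> f b < 2 ^ (j + 1) then f b else 0"]
        by simp
    qed simp
  qed
  also have "\<dots> = (\<Sum>j<L. \<Sum>b\<in>?V j. f b)"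
    using assms(1) by (subst sum.swap) (simp add: sum.inter_filter)
  finally have "real (\<Sum>b\<in>V. f b) \<le> (\<Sum>j<L. real (\<Sum>b\<in>?V j. f b))"
    by (simp only: of_nat_sum[symmetric] of_nat_le_iff)
  then have "(1 + log 2 n) * real (\<Sum>b\<in>V. f b) \<le> (1 + log 2 n) * (\<Sum>j<L. real (\<Sum>b\<in>?V j. f b))"
    using log0 by (intro mult_left_mono) auto
  also have "\<dots> = (\<Sum>j<L. (1 + log 2 n) * real (\<Sum>b\<in>?V j. f b))" by (rule sum_distrib_left)
  also have "\<dots> < (\<Sum>j<L. real (\<Sum>b\<in>V. f b))"
    using contr by (intro sum_strict_mono) (auto simp: L_def not_le)
  also have "\<dots> = L * real (\<Sum>b\<in>V. f b)" by simp
  also have "\<dots> \<le> (1 + log 2 n) * real (\<Sum>b\<in>V. f b)" using L by (intro mult_right_mono of_nat_0_le_iff)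
  finally show False by simp
qed

text \<open>Whether a joining vertex is reused or fresh is dictated by the host graph.\<close>

lemma config_imp_not_family_free:
  assumes A: "A \<subseteq> verts G" and M: "M \<subseteq> verts G" and disj: "A \<inter> M = {}"
    and config: "has_config s t A M (\<lambda>v b. {v, b} \<in> edges G)"
  shows "\<not> family_free (F_family s t) G"
proof -
  obtain r y z b where r: "r \<in> A" and yz: "y ` {1..s} \<subseteq> A" "z ` {1..t} \<subseteq> A"
    and inj: "inj_on y {1..s}" "inj_on z {1..t}" and disj_yz: "y ` {1..s} \<inter> z ` {1..t} = {}"
    and r_new: "r \<notin> y ` {1..s} \<union> z ` {1..t}"
    and bM: "b ` ({1..s} \<times> {1..t}) \<subseteq> M" and inj_b: "inj_on b ({1..s} \<times> {1..t})"
    and adj: "\<forall>i\<in>{1..s}. \<forall>j\<in>{1..t}.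
      {y i, b (i, j)} \<in> edges G \<and> {z j, b (i, j)} \<in> edges G"
    and join: "\<forall>w\<in>y ` {1..s} \<union> z ` {1..t}.
      \<exists>c\<in>M. {r, c} \<in> edges G \<and> {w, c} \<in> edges G"
    using config unfolding has_config_def by - (elim exE conjE, rule that; assumption)
  \<comment> \<open>Only the images \<open>g k\<close> of new vertices depend on the process; all
    other images are fixed by the configuration.\<close>
  define emb where "emb g v = (case v of Y i \<Rightarrow> y i | Z j \<Rightarrow> z j | B i j \<Rightarrow> b (i, j) | R \<Rightarrow> r | New k \<Rightarrow> g k)"
    for g v
  have emb_simps [simp]: "emb g (Y i) = y i" "emb g (Z j) = z j" "emb g (B i j) = b (i, j)"
    "emb g R = r" "emb g (New k) = g k" for g i j k by (simp_all add: emb_def)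
  have branch: "emb g w \<in> y ` {1..s} \<union> z ` {1..t}" if "w \<in> branch_verts s t" for g w
    using that by (auto simp: branch_verts_def)
  have emb_A: "emb g v \<in> A" if "v \<in> branch_verts s t \<union> {R}" for g v
    using that branch[of v g] yz r by auto
  \<comment> \<open>Induction over the branch vertices dealt with so far. Images of new vertices
    stay in \<open>M\<close>, hence apart from those of \<open>R\<close> and the branch
    vertices.\<close>
  have ih: "\<exists>H m g. build s t W H m \<and> g ` {..<m} \<subseteq> M \<and> inj_on (emb g) (verts H) \<and>
      (\<forall>e\<in>edges H. emb g ` e \<in> edges G)" if "finite W" "W \<subseteq> branch_verts s t" for W
    using that
  proof (induction W rule: finite_subset_induct')
    case empty
    \<comment> \<open>No new vertex exists at the start, so \<open>undefined\<close> serves as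
      \<open>g\<close>.\<close>
    have "inj_on (emb undefined) (verts (base_graph s t))"
    proof -
      let ?f = "emb undefined"
      have mid: "mid_verts s t = (\<lambda>(i, j). B i j) ` ({1..s} \<times> {1..t})"
        by (auto simp: mid_verts_def)
      have un: "inj_on ?f (U \<union> U')" if "inj_on ?f U" "inj_on ?f U'" "?f ` U \<inter> ?f ` U' = {}" for U U'
        using that unfolding inj_on_Un by blast
      have iY: "inj_on ?f (Y ` {1..s})" 
        by (rule inj_on_imageI) (use inj(1) in \<open>simp add: comp_def\<close>)
      have iZ: "inj_on ?f (Z ` {1..t})" 
        by (rule inj_on_imageI) (use inj(2) in \<open>simp add: comp_def\<close>)
      have iB: "inj_on ?f (mid_verts s t)" unfolding mid
        by (rule inj_on_imageI) (use inj_b in \<open>simp add: comp_def case_prod_unfold\<close>)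
      have img: "?f ` Y ` {1..s} = y ` {1..s}" "?f ` Z ` {1..t} = z ` {1..t}"
        "?f ` mid_verts s t = b ` ({1..s} \<times> {1..t})" "?f ` {R} = {r}"
        by (simp_all add: image_image mid case_prod_unfold)
      show ?thesis unfolding base_graph_def branch_verts_def fst_conv
      proof (intro un iY iZ iB)
        show "?f ` Y ` {1..s} \<inter> ?f ` Z ` {1..t} = {}" unfolding img by (rule disj_yz)
        show "?f ` (Y ` {1..s} \<union> Z ` {1..t}) \<inter> ?f ` mid_verts s t = {}"
          unfolding image_Un img using yz bM disj by blast
        show "?f ` (Y ` {1..s} \<union> Z ` {1..t} \<union> mid_verts s t) \<inter> ?f ` {R} = {}"
          unfolding image_Un img using r_new r bM disj by blast
      qed simp
    qed
    moreover have "\<forall>e\<in>edges (base_graph s t). emb undefined ` e \<in> edges G"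
      using adj by (auto simp: base_graph_def)
    ultimately show ?case
      by (intro exI[of _ "base_graph s t"] exI[of _ 0] exI[of _ undefined]) (auto intro: build.start)
  next
    case (insert w W)
    then obtain H m g where H: "build s t W H m" "g ` {..<m} \<subseteq> M" "inj_on (emb g) (verts H)"
      "\<forall>e\<in>edges H. emb g ` e \<in> edges G" by blast
    note vH = build_verts[OF H(1)]
    have w: "w \<in> branch_verts s t - W" using insert by auto
    obtain c where c: "c \<in> M" "{r, c} \<in> edges G" "{emb g w, c} \<in> edges G"
      using bspec[OF join branch[of w g]] w by blast
    let ?N = "mid_verts s t \<union> New ` {..<m}"
    show ?case
    proof (cases "c \<in> emb g ` ?N")
      case True
      then obtain x where x: "x \<in> ?N" "c = emb g x" by auto
      have "verts (join_to x w H) = verts H" using x vH by (auto simp: join_to_def)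
      moreover have "\<forall>e\<in>edges (join_to x w H). emb g ` e \<in> edges G"
        using H(4) c x by (auto simp: join_to_def insert_commute)
      ultimately show ?thesis using build.reuse[OF H(1) w x(1)] H by metis
    next
      case False
      let ?g = "g(m := c)"
      have agree: "emb ?g v = emb g v" if "v \<in> verts H" for v
      proof -
        have "v \<noteq> New m" using that unfolding vH by (auto simp: branch_verts_def mid_verts_def)
        then show ?thesis by (cases v) auto
      qed
      have "emb g v \<noteq> c" if "v \<in> verts H" for v
        using that False emb_A[of v g] c(1) disj unfolding vH by blast
      then have "inj_on (emb ?g) (verts (join_to (New m) w H))"
        using H(3) agree inj_on_cong[of "verts H" "emb ?g" "emb g"]
        by (auto simp: join_to_def)
      moreover have "emb ?g ` e \<in> edges G" if e: "e \<in> edges (join_to (New m) w H)" for e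
      proof -
        have "emb ?g w = emb g w" using w vH by (intro agree) auto
        moreover have "emb ?g ` e = emb g ` e" if "e \<in> edges H"
          using build_simple_graph[OF H(1)] that by (intro image_cong refl agree) (auto simp: simple_graph_def)
        ultimately show ?thesis using e H(4) c by (auto simp: join_to_def insert_commute)
      qed
      moreover have "?g ` {..<Suc m} \<subseteq> M" using H(2) c(1) by (auto simp: less_Suc_eq)
      ultimately show ?thesis using build.fresh[OF H(1) w] by blast
    qed
  qed
  have "finite (branch_verts s t)" by (simp add: branch_verts_def)
  then obtain H m g where H: "build s t (branch_verts s t) H m" "g ` {..<m} \<subseteq> M"
    "inj_on (emb g) (verts H)" "\<forall>e\<in>edges H. emb g ` e \<in> edges G"
    using ih[OF _ subset_refl] by metis
  let ?f = "emb g"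
  let ?H' = "(?f ` verts H, (`) ?f ` edges H)"
  have sg: "simple_graph H" by (rule build_simple_graph[OF H(1)])
  have eH: "e \<subseteq> verts H" "card e = 2" if "e \<in> edges H" for e
    using sg that by (auto simp: simple_graph_def)
  have "H \<in> F_family s t" using H(1) build_bipartite by (auto simp: F_family_def)
  moreover have "subgraph_of ?H' G"
  proof -
    have "?f v \<in> verts G" if v: "v \<in> verts H" for v
    proof -
      have "v \<in> branch_verts s t \<union> {R} \<or> v \<in> mid_verts s t \<or> v \<in> New ` {..<m}"
        using v build_verts[OF H(1)] by auto
      moreover have "?f v \<in> M" if "v \<in> mid_verts s t" using that bM by (auto simp: mid_verts_def)
      moreover have "?f v \<in> M" if "v \<in> New ` {..<m}" using that H(2) by auto
      ultimately show ?thesis using emb_A[of v g] A M by blast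
    qed
    moreover have "card (?f ` e) = 2" if "e \<in> edges H" for e
      using eH[OF that] H(3) by (metis card_image inj_on_subset)
    moreover have "?f ` e \<subseteq> ?f ` verts H" if "e \<in> edges H" for e
      using eH(1)[OF that] by (rule image_mono)
    moreover have "finite (verts H)" using sg by (simp add: simple_graph_def)
    ultimately show ?thesis using H(4)
      by (simp add: subgraph_of_def simple_graph_def image_subset_iff)
  qed
  moreover have "graph_iso H ?H'"
    unfolding graph_iso_def
  proof (intro exI[of _ ?f] conjI ballI)
    show "bij_betw ?f (verts H) (verts ?H')" using H(3) by (simp add: bij_betw_def)
    fix u v assume uv: "u \<in> verts H" "v \<in> verts H"
    have "{u, v} \<in> edges H" if fuv: "{?f u, ?f v} \<in> (`) ?f ` edges H"
    proof -
      obtain e where e: "e \<in> edges H" "{?f u, ?f v} = ?f ` e" using fuv by auto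
      then have "?f ` {u, v} = ?f ` e" by simp
      then have "{u, v} = e" using inj_on_image_eq_iff[OF H(3)] uv eH(1)[OF e(1)] by blast
      then show ?thesis using e by simp
    qed
    moreover have "{?f u, ?f v} \<in> (`) ?f ` edges H" if "{u, v} \<in> edges H"
      using imageI[OF that, of "(`) ?f"] by simp
    ultimately show "{u, v} \<in> edges H \<longleftrightarrow> {?f u, ?f v} \<in> edges ?H'" by auto
  qed
  ultimately show ?thesis by (auto simp: family_free_def)
qed

text \<open>The factor \<open>4 * (1 + log 2 n)\<close> pays for the cut (\<open>2\<close>), the
  dyadic class (\<open>1 + log 2 n\<close>) and the deletion of vertices of small degree
  (\<open>2\<close>). What is left satisfies the hypotheses of \<open>few_edges\<close>.\<close>

lemma family_free_few_edges:
  fixes G :: "'a ugraph" and s t q \<kappa> n :: nat and c e :: real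
  defines "q \<equiv> 4 ^ (1 + s + t)" and "\<kappa> \<equiv> t * s * (s * t) * s" and "c \<equiv> real (4 * 4 ^ (1 + s + t) * (s * t))"
  assumes G: "simple_graph G" "card (verts G) = n" "family_free (F_family s t) G"
    and s: "1 \<le> s" and t: "1 \<le> t" and n: "1 \<le> n"
    and e: "0 < e" "e * (4 * (1 + log 2 n)) \<le> card (edges G)"
    and e1: "2 * q * n \<le> e"
    and e2: "c * (2 * q) * n ^ 4 \<le> e ^ 3"
    and e3: "4 * \<kappa> * q * c ^ (s + 1) * n ^ (3 * s + 2) \<le> e ^ (2 * s + 2)"
    and e4: "4 * (16 * s ^ 2 * \<kappa> ^ 2 * q * (s * t)) * c ^ 3 * n ^ 7 < e ^ 5"
  shows False
proof -
  let ?V = "verts G"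
  let ?E = "\<lambda>v b. {v, b} \<in> edges G"
  have finV: "finite ?V" and edge: "\<And>e. e \<in> edges G \<Longrightarrow> e \<subseteq> ?V \<and> card e = 2"
    using G(1) by (auto simp: simple_graph_def)
  obtain A where A: "A \<subseteq> ?V" "card (edges G) \<le> 2 * card {e \<in> edges G. card (e \<inter> A) = 1}"
    using exists_large_cut[OF finV edge] by blast
  have fin_A: "finite A" using A finV finite_subset by auto
  have cardA: "card A \<le> n" using A G(2) finV card_mono by blast
  define f where "f b = card {v \<in> A. ?E v b}" for b
  have f_le: "f b \<le> n" for b
    unfolding f_def by (rule order_trans[OF card_mono cardA]) (use fin_A in auto)
  have cut: "card {e \<in> edges G. card (e \<inter> A) = 1} \<le> (\<Sum>b\<in>?V - A. f b)"
  proof -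
    have sub: "{e \<in> edges G. card (e \<inter> A) = 1} \<subseteq> (\<lambda>(b, v). {v, b}) ` (SIGMA b:?V - A. {v \<in> A. ?E v b})"
    proof
      fix e assume e: "e \<in> {e \<in> edges G. card (e \<inter> A) = 1}"
      then obtain v where v: "e \<inter> A = {v}" by (auto simp: card_1_singleton_iff)
      have "card e = 2" "e \<subseteq> ?V" using edge e by auto
      then obtain x y where xy: "e = {x, y}" "x \<noteq> y" by (auto simp: card_2_iff)
      have "v \<in> e" using v by auto
      then obtain w where w: "e = {v, w}" "w \<noteq> v" using xy by (auto simp: insert_commute)
      then have "w \<in> ?V - A" "v \<in> A" using v \<open>e \<subseteq> ?V\<close> by auto
      then show "e \<in> (\<lambda>(b, v). {v, b}) ` (SIGMA b:?V - A. {v \<in> A. ?E v b})"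
        using w e by (intro image_eqI[of _ _ "(w, v)"]) auto
    qed
    have fin: "finite (SIGMA b:?V - A. {v \<in> A. ?E v b})" using finV fin_A by auto
    have "card {e \<in> edges G. card (e \<inter> A) = 1} \<le> card (SIGMA b:?V - A. {v \<in> A. ?E v b})"
      using surj_card_le[OF fin sub] .
    also have "\<dots> = (\<Sum>b\<in>?V - A. f b)" using finV fin_A by (simp add: card_SigmaI f_def)
    finally show ?thesis .
  qed
  obtain j where j: "real (\<Sum>b\<in>?V - A. f b) \<le>
      (1 + log 2 n) * (\<Sum>b | b \<in> ?V - A \<and> 2 ^ j \<le> f b \<and> f b < 2 ^ (j + 1). f b)"
    using exists_dyadic_class[of "?V - A" n f] finV n f_le by auto
  define M where "M = {b. b \<in> ?V - A \<and> 2 ^ j \<le> f b \<and> f b < 2 ^ (j + 1)}"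
  define eM where "eM = real (\<Sum>b\<in>M. f b)"
  have fin_M: "finite M" using finV by (simp add: M_def)
  have "M \<subseteq> ?V" by (auto simp: M_def)
  then have cardM: "card M \<le> n" using G(2) finV card_mono by blast
  have logpos: "0 < 1 + log 2 n"
  proof -
    have "0 \<le> log 2 n" using n by simp
    then show ?thesis by linarith
  qed
  have eM_ge: "2 * e \<le> eM"
  proof -
    have "real (card (edges G)) \<le> 2 * real (\<Sum>b\<in>?V - A. f b)" using A(2) cut by linarith
    with j have "e * (4 * (1 + log 2 n)) \<le> 2 * ((1 + log 2 n) * eM)"
      using e(2) unfolding eM_def M_def by linarith
    then have "(2 * e) * (2 * (1 + log 2 n)) \<le> eM * (2 * (1 + log 2 n))" by (simp add: algebra_simps)
    then show ?thesis using logpos by (simp only: mult_le_cancel_right_pos mult_pos_pos zero_less_numeral)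
  qed
  \<comment> \<open>Degrees are counted into \<open>M\<close>, which stays fixed, so one round of
    deletion suffices; it loses at most half of \<open>eM\<close>.\<close>
  define A' where "A' = {v \<in> A. eM / (2 * n) \<le> card {b \<in> M. ?E v b}}"
  have A'_A: "A' \<subseteq> A" by (auto simp: A'_def)
  have fin_A': "finite A'" using A'_A fin_A finite_subset by auto
  have A'M: "A' \<inter> M = {}" using A'_A by (auto simp: M_def)
  have "\<not> has_config s t A' M ?E"
  proof
    assume "has_config s t A' M ?E"
    then have "\<not> family_free (F_family s t) G"
      using A'_A A(1) \<open>M \<subseteq> ?V\<close> A'M by (intro config_imp_not_family_free) auto
    then show False using G(3) by simp
  qed
  then interpret config_free A' M ?E s t
    using fin_A' fin_M s t by unfold_locales
  have nbhd_eq: "nbhd b = {v \<in> A'. ?E v b}" for b by (simp add: nbhd_def)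
  have sum_nbhd: "eM / 2 \<le> (\<Sum>b\<in>M. card (nbhd b))"
  proof -
    have swap: "(\<Sum>b\<in>M. card {v \<in> U. ?E v b}) = (\<Sum>v\<in>U. card {b \<in> M. ?E v b})" if "finite U" for U
    proof -
      have "(\<Sum>b\<in>M. card {v \<in> U. ?E v b}) = (\<Sum>b\<in>M. \<Sum>v\<in>U. if ?E v b then 1 else 0)"
        using that by (simp add: sum.If_cases Int_def)
      also have "\<dots> = (\<Sum>v\<in>U. card {b \<in> M. ?E v b})"
        by (subst sum.swap) (use fin_M in \<open>simp add: sum.If_cases Int_def\<close>)
      finally show ?thesis .
    qed
    have "eM = (\<Sum>v\<in>A. real (card {b \<in> M. ?E v b}))"
      using swap[OF fin_A] by (simp add: eM_def f_def flip: of_nat_sum)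
    also have "\<dots> = (\<Sum>v\<in>A'. real (card {b \<in> M. ?E v b})) + (\<Sum>v\<in>A - A'. real (card {b \<in> M. ?E v b}))"
      using sum.subset_diff[OF A'_A fin_A] by (simp add: add.commute)
    also have "(\<Sum>v\<in>A - A'. real (card {b \<in> M. ?E v b})) \<le> card (A - A') * (eM / (2 * n))"
      by (rule sum_bounded_above) (auto simp: A'_def)
    also have "card (A - A') * (eM / (2 * n)) \<le> n * (eM / (2 * n))"
    proof (rule mult_right_mono)
      have "card (A - A') \<le> card A" using fin_A by (intro card_mono) auto
      then show "real (card (A - A')) \<le> real n" using cardA by simp
    qed (simp add: eM_def sum_nonneg)
    also have "\<dots> = eM / 2" using n by simp
    finally have "eM / 2 \<le> (\<Sum>v\<in>A'. real (card {b \<in> M. ?E v b}))" by simp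
    also have "\<dots> = real (\<Sum>b\<in>M. card (nbhd b))" using swap[OF fin_A'] by (simp add: nbhd_eq flip: of_nat_sum)
    finally show ?thesis .
  qed
  have ee: "e \<le> eM / 2" using eM_ge by simp
  have pow: "e ^ k \<le> (eM / 2) ^ k" for k using ee e(1) by (intro power_mono) auto
  show False
  proof (rule few_edges[of "eM / 2" "real n" "2 ^ (j + 1)"])
    show "0 < eM / 2" using ee e(1) by linarith
    show "eM / 2 \<le> (\<Sum>b\<in>M. card (nbhd b))" by (rule sum_nbhd)
    show "0 < real n" using n by simp
    have "card A' \<le> card A" using fin_A A'_A by (rule card_mono)
    then show "real (card A') \<le> real n" using cardA by simp
    show "real (card M) \<le> real n" using cardM by simp
    show "eM / 2 / real n \<le> card {b \<in> M. ?E v b}" if "v \<in> A'" for v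
      using that by (simp add: A'_def)
    show "card (nbhd b) \<le> 2 ^ (j + 1)" if "b \<in> M" for b
    proof -
      have "card (nbhd b) \<le> f b" unfolding nbhd_eq f_def using fin_A A'_A by (intro card_mono) auto
      then show ?thesis using that by (simp add: M_def)
    qed
    \<comment> \<open>The lower end of the dyadic range bounds \<open>card M\<close>, by way of the
      degrees \<open>f b\<close> before the deletion.\<close>
    have "(\<Sum>b\<in>M. 2 ^ j) \<le> (\<Sum>b\<in>M. f b)" by (intro sum_mono) (auto simp: M_def)
    then have "2 ^ (j + 1) * card M \<le> 2 * (\<Sum>b\<in>M. f b)" by (simp add: mult.commute)
    then have "real (2 ^ (j + 1) * card M) \<le> real (2 * (\<Sum>b\<in>M. f b))" by (simp only: of_nat_le_iff)
    also have "\<dots> = 2 * eM" by (simp add: eM_def)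
    finally have "real (2 ^ (j + 1) * card M) \<le> 2 * eM" .
    then show "real (2 ^ (j + 1) * card M) \<le> 4 * (eM / 2)" by simp
    show "real (2 * 4 ^ (1 + s + t)) * real n \<le> eM / 2" using e1 ee by (simp add: q_def)
    show "real (4 * 4 ^ (1 + s + t) * (s * t)) * real (2 * 4 ^ (1 + s + t)) * real n ^ 4 \<le> (eM / 2) ^ 3"
      using e2 pow[of 3] by (simp add: q_def c_def)
    show "real (4 * (t * s * (s * t) * s) * 4 ^ (1 + s + t)) * real (4 * 4 ^ (1 + s + t) * (s * t)) ^ (s + 1) *
        real n ^ (3 * s + 2) \<le> (eM / 2) ^ (2 * s + 2)"
      using order_trans[OF e3 pow] by (simp add: q_def c_def \<kappa>_def)
    show "real (4 * (16 * s ^ 2 * (t * s * (s * t) * s) ^ 2 * 4 ^ (1 + s + t) * (s * t))) *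
        real (4 * 4 ^ (1 + s + t) * (s * t)) ^ 3 * real n ^ 7 < (eM / 2) ^ 5"
      using less_le_trans[OF e4 pow] by (simp add: q_def c_def \<kappa>_def)
  qed
qed

section \<open>Comparison of exponents and absorption of the logarithm\<close>

text \<open>As \<open>1 \<le> K\<close> gives \<open>K \<le> K ^ k\<close>, the numerical hypotheses
  on \<open>e\<close> reduce to comparing \<open>j\<close> with \<open>\<beta> * k\<close>.\<close>

lemma power_le_of_powr_le:
  fixes K e n \<beta> :: real
  assumes "1 \<le> n" "1 \<le> K" "real j \<le> \<beta> * k" "1 \<le> k" "K * n powr \<beta> \<le> e"
  shows "K * n ^ j \<le> e ^ k"
proof -
  have "K * n ^ j \<le> K ^ k * n ^ j"
    using assms power_increasing[of 1 k K] by (intro mult_right_mono) auto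
  also have "\<dots> = K ^ k * n powr j" using assms by (simp add: powr_realpow)
  also have "K ^ k * n powr j \<le> K ^ k * n powr (\<beta> * k)"
    using assms by (intro mult_left_mono powr_mono) auto
  also have "\<dots> = (K * n powr \<beta>) ^ k"
    using assms by (simp add: power_mult_distrib powr_powr[symmetric] powr_realpow)
  also have "\<dots> \<le> e ^ k" using assms by (intro power_mono) auto
  finally show ?thesis .
qed

text \<open>Pays for the dyadic loss with an arbitrarily small power of \<open>n\<close>, through
  \<open>ln n \<le> n powr \<epsilon> / \<epsilon>\<close>.\<close>

lemma one_plus_log_le_powr:
  fixes n \<epsilon> :: real
  assumes "1 \<le> n" "0 < \<epsilon>"
  shows "1 + log 2 n \<le> (1 + 1 / (\<epsilon> * ln 2)) * n powr \<epsilon>"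
proof -
  have "1 \<le> n powr \<epsilon>" using assms by (simp add: ge_one_powr_ge_zero)
  moreover have "log 2 n \<le> n powr \<epsilon> / \<epsilon> / ln 2"
    unfolding log_def using ln_powr_bound[OF assms] by (intro divide_right_mono) auto
  ultimately show ?thesis by (simp add: algebra_simps)
qed

text \<open>The counting is run with \<open>e = K * n powr \<beta>\<close> for an exponent
  \<open>\<beta>\<close> below the claimed \<open>a\<close>; the gap \<open>\<epsilon>\<close>
  absorbs the logarithm.\<close>

lemma family_free_card_edges_le:
  fixes s t :: nat
  assumes "3 \<le> s" and "s \<le> t"
  shows "\<exists>C :: real. \<forall>n. \<forall>G :: 'a ugraph.
            simple_graph G \<and> card (verts G) = n \<and> family_free (F_family s t) G \<longrightarrow>
            real (card (edges G)) \<le>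
              C * real n powr (1 + (real s ^ 2 + 1) / (2 * real s + 2 * real s ^ 2))"
proof -
  define a where "a = 1 + (real s ^ 2 + 1) / (2 * real s + 2 * real s ^ 2)"
  \<comment> \<open>For \<open>s = 3\<close> this gives \<open>\<beta> = 7 / 5\<close>, exactly what
    the comparison of \<open>n ^ 7\<close> with \<open>e ^ 5\<close> demands.\<close>
  define \<epsilon> where "\<epsilon> = 1 / (5 * real s * (real s + 1))"
  define \<beta> where "\<beta> = a - \<epsilon>"
  define q :: nat where "q = 4 ^ (1 + s + t)"
  define \<kappa> where "\<kappa> = t * s * (s * t) * s"
  define c where "c = real (4 * 4 ^ (1 + s + t) * (s * t))"
  \<comment> \<open>The initial \<open>1\<close> gives \<open>1 \<le> K\<close> and makes the
    comparison with the last summand strict.\<close>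
  define K where "K = 1 + real (2 * q) + c * real (2 * q) + real (4 * \<kappa> * q) * c ^ (s + 1) +
    real (4 * (16 * s ^ 2 * \<kappa> ^ 2 * q * (s * t))) * c ^ 3"
  define c0 where "c0 = 1 + 1 / (\<epsilon> * ln 2)"
  have s3: "3 \<le> real s" using assms by simp
  have epos: "0 < \<epsilon>" using s3 by (simp add: \<epsilon>_def)
  have c0: "1 \<le> c0" using epos by (simp add: c0_def)
  have cnn: "0 \<le> c" by (simp add: c_def)
  have nn: "0 \<le> real (2 * q)" "0 \<le> c * real (2 * q)" "0 \<le> real (4 * \<kappa> * q) * c ^ (s + 1)"
    "0 \<le> real (4 * (16 * s ^ 2 * \<kappa> ^ 2 * q * (s * t))) * c ^ 3"
    using cnn by (auto intro!: mult_nonneg_nonneg)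
  have K: "1 \<le> K" "real (2 * q) \<le> K" "c * real (2 * q) \<le> K" "real (4 * \<kappa> * q) * c ^ (s + 1) \<le> K"
    "real (4 * (16 * s ^ 2 * \<kappa> ^ 2 * q * (s * t))) * c ^ 3 < K"
    using nn unfolding K_def by linarith+
  have \<beta>_eq: "\<beta> = 1 + (5 * real s ^ 2 + 3) / (10 * real s * (real s + 1))"
  proof -
    define w where "w = real s * (real s + 1)"
    have "0 < w" using s3 by (simp add: w_def)
    have "a = 1 + (real s ^ 2 + 1) / (2 * w)" by (simp add: a_def w_def algebra_simps power2_eq_square)
    moreover have "\<epsilon> = 1 / (5 * w)" by (simp add: \<epsilon>_def w_def mult.assoc)
    ultimately have "\<beta> = 1 + (5 * real s ^ 2 + 3) / (10 * w)"
      using \<open>0 < w\<close> by (simp add: \<beta>_def field_simps)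
    then show ?thesis by (simp add: w_def mult.assoc)
  qed
  have \<beta>5: "7 \<le> \<beta> * 5"
  proof -
    \<comment> \<open>Here \<open>3 \<le> s\<close> enters: the claim amounts to
      \<open>s ^ 2 - 4 * s + 3 \<ge> 0\<close>.\<close>
    have "0 \<le> (real s - 3) * (real s - 1)" using s3 by (intro mult_nonneg_nonneg) auto
    then show ?thesis using s3 by (simp add: \<beta>_eq field_simps power2_eq_square)
  qed
  have \<beta>s: "3 * s + 2 \<le> \<beta> * (2 * s + 2)"
  proof -
    have "\<beta> * (2 * s + 2) =
        2 * s + 2 + ((5 * real s ^ 2 + 3) * (2 * (real s + 1))) / (5 * real s * (2 * (real s + 1)))"
      by (simp add: \<beta>_eq algebra_simps)
    also have "\<dots> = 2 * s + 2 + (5 * real s ^ 2 + 3) / (5 * real s)"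
      using s3 by (subst mult_divide_mult_cancel_right) auto
    also have "\<dots> \<ge> 2 * s + 2 + (5 * real s ^ 2) / (5 * real s)"
      using s3 by (intro add_left_mono divide_right_mono) auto
    finally show ?thesis using s3 by (simp add: power2_eq_square)
  qed
  have bound: "real (card (edges G)) \<le> (4 * c0 * K) * real n powr a"
    if G: "simple_graph G" "card (verts G) = n" "family_free (F_family s t) G" for n and G :: "'a ugraph"
  proof (cases "n = 0")
    case True
    then have "verts G = {}" using G by (auto simp: simple_graph_def)
    then have "edges G = {}" using G(1) by (fastforce simp: simple_graph_def)
    then show ?thesis using c0 K(1) by simp
  next
    case False
    then have n1: "1 \<le> n" and n1': "1 \<le> real n" by auto
    show ?thesis
    proof (rule ccontr)
      assume "\<not> ?thesis"
      then have large: "4 * c0 * K * n powr a < card (edges G)" by simp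
      define e where "e = K * n powr \<beta>"
      have pow: "K * real n ^ j \<le> e ^ k" if "real j \<le> \<beta> * k" "1 \<le> k" for j k
        by (rule power_le_of_powr_le[OF n1' K(1) that]) (simp add: e_def)
      have le: "x * real n ^ j \<le> e ^ k" if "x \<le> K" "real j \<le> \<beta> * k" "1 \<le> k" for x j k
        using mult_right_mono[OF that(1), of "real n ^ j"] pow[OF that(2,3)] by simp
      show False
      proof (rule family_free_few_edges[OF G _ _ n1, of e])
        show "1 \<le> s" "1 \<le> t" using assms by auto
        show "0 < e" using K(1) n1 by (simp add: e_def)
        have "e * (4 * (1 + log 2 n)) \<le> e * (4 * (c0 * n powr \<epsilon>))"
          using one_plus_log_le_powr[OF n1' epos] \<open>0 < e\<close>
          by (intro mult_left_mono) (auto simp: c0_def)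
        also have "\<dots> = 4 * c0 * K * (n powr \<beta> * n powr \<epsilon>)" by (simp add: e_def)
        also have "n powr \<beta> * n powr \<epsilon> = n powr a" by (simp add: \<beta>_def flip: powr_add)
        finally show "e * (4 * (1 + log 2 n)) \<le> card (edges G)" using large by linarith
        show "real (2 * 4 ^ (1 + s + t) * n) \<le> e"
          using le[OF K(2), of 1 1] \<beta>5 by (simp add: q_def)
        show "real (4 * 4 ^ (1 + s + t) * (s * t)) * real (2 * 4 ^ (1 + s + t)) * real (n ^ 4) \<le> e ^ 3"
          using le[OF K(3), of 4 3] \<beta>5 by (simp add: q_def c_def)
        show "real (4 * (t * s * (s * t) * s) * 4 ^ (1 + s + t)) *
            real (4 * 4 ^ (1 + s + t) * (s * t)) ^ (s + 1) * real (n ^ (3 * s + 2)) \<le> e ^ (2 * s + 2)"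
          using le[OF K(4), of "3 * s + 2" "2 * s + 2"] \<beta>s by (simp add: q_def c_def \<kappa>_def)
        have "real (4 * (16 * s ^ 2 * \<kappa> ^ 2 * q * (s * t))) * c ^ 3 * real n ^ 7 < K * real n ^ 7"
          using K(5) n1 by (intro mult_strict_right_mono) auto
        also have "\<dots> \<le> e ^ 5" using pow[of 7 5] \<beta>5 by simp
        finally show "real (4 * (16 * s ^ 2 * (t * s * (s * t) * s) ^ 2 * 4 ^ (1 + s + t) * (s * t))) *
            real (4 * 4 ^ (1 + s + t) * (s * t)) ^ 3 * real (n ^ 7) < e ^ 5"
          by (simp add: q_def c_def \<kappa>_def)
      qed
    qed
  qed
  show ?thesis
    by (rule exI[of _ "4 * c0 * K"]) (use bound in \<open>auto simp: a_def\<close>)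
qed

section \<open>The extremal number\<close>

text \<open>Serves \<open>ex_num_attained\<close>: an edgeless host avoids every graph that has an
  edge.\<close>

lemma F_family_edges_nonempty:
  assumes "1 \<le> s" "1 \<le> t" "F \<in> F_family s t"
  shows "edges F \<noteq> {}"
proof -
  have "edges (base_graph s t) \<subseteq> edges H" if "build s t W H m" for W H m
    using that by induction (auto simp: join_to_def)
  moreover have "{Y 1, B 1 1} \<in> edges (base_graph s t)" using assms by (auto simp: base_graph_def)
  ultimately show ?thesis using assms(3) by (fastforce simp: F_family_def)
qed

text \<open>The set under \<open>Max\<close> is finite, as edge sets lie in the power set of the
  vertex set, and nonempty, thanks to the edgeless graph.\<close>

lemma ex_num_attained:
  assumes "\<And>F. F \<in> \<F> \<Longrightarrow> simple_graph F \<and> edges F \<noteq> {}"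
  shows "\<exists>G :: nat ugraph. simple_graph G \<and> card (verts G) = n \<and> family_free \<F> G \<and>
    ex_num n \<F> = card (edges G)"
proof -
  let ?S = "{card (edges G) | G :: nat ugraph. simple_graph G \<and> card (verts G) = n \<and> family_free \<F> G}"
  have "?S \<subseteq> {..2 ^ n}"
  proof
    fix k assume "k \<in> ?S"
    then obtain G :: "nat ugraph" where G: "k = card (edges G)" "simple_graph G" "card (verts G) = n"
      by blast
    have "edges G \<subseteq> Pow (verts G)" "finite (verts G)" using G(2) by (auto simp: simple_graph_def)
    then have "k \<le> card (Pow (verts G))" unfolding G(1) by (intro card_mono) auto
    then show "k \<in> {..2 ^ n}" using G \<open>finite (verts G)\<close> by (simp add: card_Pow)
  qed
  then have fin: "finite ?S" by (rule finite_subset) simp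
  let ?G = "({..<n}, {}) :: nat ugraph"
  have "family_free \<F> ?G"
    unfolding family_free_def
  proof clarify
    fix F a b assume F: "F \<in> \<F>" and sub: "subgraph_of (a, b) ?G" and iso: "graph_iso F (a, b)"
    obtain e where e: "e \<in> edges F" using assms[OF F] by auto
    then have "e \<subseteq> verts F" "card e = 2" using assms[OF F] by (auto simp: simple_graph_def)
    then obtain u v where uv: "e = {u, v}" "u \<in> verts F" "v \<in> verts F" by (auto simp: card_2_iff)
    then have "b \<noteq> {}" using iso e by (auto simp: graph_iso_def)
    then show False using sub by (simp add: subgraph_of_def)
  qed
  then have "card (edges ?G) \<in> ?S"
    by (intro CollectI exI[of _ ?G]) (simp add: simple_graph_def)
  then have "Max ?S \<in> ?S" using fin by (intro Max_in) auto
  then show ?thesis unfolding ex_num_def by auto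
qed

theorem theorem1p4:
  fixes s t :: nat
  assumes "3 \<le> s" and "s \<le> t"
  shows "(\<lambda>n. real (ex_num n (F_family s t)))
           \<in> O(\<lambda>n. real n powr (1 + (real s ^ 2 + 1) / (2 * real s + 2 * real s ^ 2))) \<and>
         (\<exists>C :: real. \<forall>n. \<forall>G :: 'a ugraph.
            simple_graph G \<and> card (verts G) = n \<and> family_free (F_family s t) G \<longrightarrow>
            real (card (edges G)) \<le>
              C * real n powr (1 + (real s ^ 2 + 1) / (2 * real s + 2 * real s ^ 2)))"
proof
  \<comment> \<open>The bound is taken for graphs on natural numbers, over which
    \<open>ex_num\<close> maximises; it holds for every \<open>n\<close>, not only
    eventually.\<close>
  obtain C where C: "\<And>n (G :: nat ugraph). simple_graph G \<Longrightarrow> card (verts G) = n \<Longrightarrow>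
      family_free (F_family s t) G \<Longrightarrow> real (card (edges G)) \<le>
      C * real n powr (1 + (real s ^ 2 + 1) / (2 * real s + 2 * real s ^ 2))"
    using family_free_card_edges_le[OF assms] by blast
  show "(\<lambda>n. real (ex_num n (F_family s t)))
      \<in> O(\<lambda>n. real n powr (1 + (real s ^ 2 + 1) / (2 * real s + 2 * real s ^ 2)))"
  proof (rule bigoI[of _ C], rule always_eventually, rule allI)
    fix n
    have "simple_graph F \<and> edges F \<noteq> {}" if F: "F \<in> F_family s t" for F
    proof -
      obtain m where "build s t (branch_verts s t) F m" using F by (auto simp: F_family_def)
      then show ?thesis
        using F F_family_edges_nonempty[of s t F] build_simple_graph[of s t _ F m] assms by simp
    qed
    then obtain G :: "nat ugraph" where "simple_graph G" "card (verts G) = n"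
      "family_free (F_family s t) G" "ex_num n (F_family s t) = card (edges G)"
      using ex_num_attained[of "F_family s t" n] by auto
    then show "norm (real (ex_num n (F_family s t))) \<le>
        C * norm (real n powr (1 + (real s ^ 2 + 1) / (2 * real s + 2 * real s ^ 2)))"
      using C[of G n] by simp
  qed
qed (rule family_free_card_edges_le[OF assms])

end
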